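(* For $n\ge1$, $$\sum_{\pi\in\mathfrak{S}_n(2413,3142)}t^{\mathsf{des}(\pi)}x^{\mathsf{dd}(\pi)}y^{\mathsf{iar}(\pi)}=\sum_{\pi\in\mathfrak{S}_n(2413,4213)}t^{\mathsf{des}(\pi)}x^{\mathsf{dd}(\pi)}y^{\mathsf{iar}(\pi)}.$$
   Context: $\mathfrak{S}_n$ is the set of permutations $\pi=\pi(1)\cdots\pi(n)$ of $[n]=\{1,\dots,n\}$. A permutation $\pi\in\mathfrak{S}_n$ contains the pattern $\sigma\in\mathfrak{S}_k$ if there are $j_1<\cdots<j_k$ such that $\pi(j_a)<\pi(j_b)$ if and only if $\sigma(a)<\sigma(b)$ for all $1\le a<b\le k$; otherwise it avoids $\sigma$. $\mathfrak{S}_n(\sigma_1,\sigma_2)$ is the set of permutations in $\mathfrak{S}_n$ avoiding both $\sigma_1$ and $\sigma_2$. For $\pi\in\mathfrak{S}_n$: $\mathrm{DES}(\pi)=\{i\in[n-1]:\pi(i)>\pi(i+1)\}$, $\mathsf{des}(\pi)=|\mathrm{DES}(\pi)|$, $\mathsf{iar}(\pi)=\min(\mathrm{DES}(\pi)\cup\{n\})$, and $\mathsf{dd}(\pi)$ is the number of double descents, i.e. of indices $i\in[n]$ with $\pi(i-1)>\pi(i)>\pi(i+1)$, where $\pi(0)=\pi(n+1)=0$. The variables $t,x,y$ are commuting indeterminates. *)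

theory Defs
  imports "HOL-Combinatorics.Permutations" "HOL-Computational_Algebra.Polynomial"
begin

text \<open>
  A permutation of \<open>[n]\<close> is a function \<open>\<pi>\<close> with \<open>\<pi> permutes {1..n}\<close>. Patterns are given by their
  one-line notation: \<open>[2, 4, 1, 3]\<close> is the pattern 2413. Lists are indexed from 0, so the
  value \<open>\<sigma>(a)\<close> of the pattern is \<open>\<sigma> ! (a - 1)\<close>.
\<close>

definition contains_pattern :: "nat \<Rightarrow> (nat \<Rightarrow> nat) \<Rightarrow> nat list \<Rightarrow> bool" where
  "contains_pattern n \<pi> \<sigma> \<longleftrightarrow>
     (\<exists>j. strict_mono_on {1..length \<sigma>} j \<and> j ` {1..length \<sigma>} \<subseteq> {1..n} \<and>
        (\<forall>a b. 1 \<le> a \<and> a < b \<and> b \<le> length \<sigma> \<longrightarrow>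
           (\<pi> (j a) < \<pi> (j b) \<longleftrightarrow> \<sigma> ! (a - 1) < \<sigma> ! (b - 1))))"

definition avoiders :: "nat \<Rightarrow> nat list \<Rightarrow> nat list \<Rightarrow> (nat \<Rightarrow> nat) set" where
  "avoiders n \<sigma> \<tau> =
     {\<pi>. \<pi> permutes {1..n} \<and> \<not> contains_pattern n \<pi> \<sigma> \<and> \<not> contains_pattern n \<pi> \<tau>}"

definition DES :: "nat \<Rightarrow> (nat \<Rightarrow> nat) \<Rightarrow> nat set" where
  "DES n \<pi> = {i \<in> {1..n - 1}. \<pi> i > \<pi> (i + 1)}"

definition des :: "nat \<Rightarrow> (nat \<Rightarrow> nat) \<Rightarrow> nat" where
  "des n \<pi> = card (DES n \<pi>)"

definition iar :: "nat \<Rightarrow> (nat \<Rightarrow> nat) \<Rightarrow> nat" where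
  "iar n \<pi> = Min (DES n \<pi> \<union> {n})"

text \<open>
  The convention \<open>\<pi>(0) = \<pi>(n + 1) = 0\<close>. It has to be imposed, since a function that permutes
  \<open>{1..n}\<close> fixes \<open>n + 1\<close>.
\<close>

definition pad :: "nat \<Rightarrow> (nat \<Rightarrow> nat) \<Rightarrow> nat \<Rightarrow> nat" where
  "pad n \<pi> i = (if i \<in> {1..n} then \<pi> i else 0)"

definition dd :: "nat \<Rightarrow> (nat \<Rightarrow> nat) \<Rightarrow> nat" where
  "dd n \<pi> = card {i \<in> {1..n}. pad n \<pi> (i - 1) > pad n \<pi> i \<and> pad n \<pi> i > pad n \<pi> (i + 1)}"

text \<open>
  The polynomial ring \<open>\<int>[t, x, y]\<close> is the iterated polynomial ring \<open>\<int>[t][x][y]\<close>, with the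
  three indeterminates embedded as follows.
\<close>

definition var_t :: "int poly poly poly" where
  "var_t = [:[:[:0, 1:]:]:]"

definition var_x :: "int poly poly poly" where
  "var_x = [:[:0, 1:]:]"

definition var_y :: "int poly poly poly" where
  "var_y = [:0, 1:]"

end

theory Submission
  imports Defs "HOL-Library.Sublist" "HOL-Combinatorics.Multiset_Permutations"
    "HOL-Computational_Algebra.Formal_Power_Series"
begin

text \<open>
  Both sums satisfy the same functional equation, and this equation has only one solution.
  Let \<open>S(y)\<close> be the generating function, in a variable \<open>z\<close> marking the length, of the weights
  \<open>t ^ des * x ^ dd * y ^ iar\<close> over the nonempty members of one of the two classes, and let
  \<open>S = S(1)\<close>. For both classes
  \<open>S(y) = y z (1 + S(y)) + t S(y) (x z + z S + S\<^sup>2)\<close>.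
  Setting \<open>y = 1\<close> gives a cubic equation for \<open>S\<close>, which determines \<open>S\<close> because its linearisation has
  constant coefficient \<open>1\<close>; then the equation is linear in \<open>S(y)\<close> and determines \<open>S(y)\<close> too.

  In both classes the first term on the right counts the permutations that start with their minimum.
  The two classes reach the factor \<open>x z + z S + S\<^sup>2\<close> in different ways.

  \<^item> \<^emph>\<open>Avoiding 2413 and 3142 (separable permutations).\<close> A separable permutation of length at least 2
    is a direct sum if its first entry is smaller than its last one, and a skew sum otherwise.
    If \<open>\<pi>\<close> does not start with its minimum, then its first direct summand is a skew sum; splitting off
    the last skew component \<open>\<delta>\<close> of that summand gives \<open>\<pi> = (\<sigma> \<ominus> \<delta>) \<oplus> v\<close> with \<open>v\<close> possibly empty.
    Here \<open>\<sigma>\<close> is followed by a descent, so it carries the initial run, and contributes \<open>S(y)\<close>.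
    If \<open>\<delta>\<close> is a single entry, the pair \<open>(\<delta>, v)\<close> contributes \<open>x z\<close> when \<open>v\<close> is empty, the entry
    being then a double descent, and \<open>z S\<close> otherwise. If not, then \<open>\<delta> = \<alpha> \<oplus> \<beta>\<close> with \<open>\<beta>\<close> indecomposable,
    and \<open>\<beta> \<oplus> v\<close> is an arbitrary separable permutation, while \<open>\<alpha>\<close> is one with larger neighbours on both
    sides; reversing and complementing \<open>\<alpha>\<close> shows that each of these two factors is \<open>S\<close>.

  \<^item> \<^emph>\<open>Avoiding 2413 and 4213.\<close> If the minimum is the last entry, it is a double descent and its removal
    gives \<open>t x z S(y)\<close>. Otherwise \<open>\<pi> = \<alpha> 1 \<beta>\<close>, and the entries of \<open>\<alpha>\<close> form an interval of values.
    So \<open>\<pi>\<close> is given by \<open>\<alpha>\<close>, \<open>\<beta>\<close> and the place of that interval among the values of \<open>\<beta>\<close>,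
    subject to the condition that a single entry put in this place in front of \<open>\<beta>\<close> creates no forbidden
    pattern. Let \<open>k(\<beta>)\<close> count the admissible places other than the lowest one, and let \<open>H\<close> be the
    generating function with the additional weight \<open>k\<close>; then these \<open>\<pi>\<close> contribute \<open>t z S(y) (S + H)\<close>,
    and it remains to see that \<open>z H = S\<^sup>2\<close>. Now \<open>k\<close> itself obeys a simple rule: it drops by exactly one
    on passing from a permutation to what is left of it, namely the permutation without its minimum if
    this comes first or last, and \<open>\<alpha>\<close> if it is \<open>\<alpha> 1 \<beta>\<close>. Thus if \<open>S = z + Q S\<close> expresses the
    decomposition for \<open>y = 1\<close>, then \<open>H = S + Q H\<close>, and \<open>z H\<close> and \<open>S\<^sup>2\<close> both equal \<open>z S / (1 - Q)\<close>.

  All of this is carried out for one-line notations, that is, lists of distinct numbers. Since a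
  block of a decomposition is flanked by other blocks, double descents are counted relative to two flags
  saying whether the block is preceded by a larger and followed by a smaller entry. The convention
  \<open>\<pi>(0) = \<pi>(n + 1) = 0\<close> corresponds to the flags \<open>False\<close> and \<open>True\<close>.
\<close>

section \<open>Patterns and statistics of lists\<close>

definition avoids :: "(nat \<Rightarrow> nat \<Rightarrow> nat \<Rightarrow> nat \<Rightarrow> bool) \<Rightarrow> nat list \<Rightarrow> bool" where
  "avoids R xs \<longleftrightarrow> (\<forall>a b c d. subseq [a, b, c, d] xs \<longrightarrow> \<not> R a b c d)"

text \<open>
  The arguments are the values at the four positions, in the order of the positions.
\<close>

definition p2413 :: "nat \<Rightarrow> nat \<Rightarrow> nat \<Rightarrow> nat \<Rightarrow> bool" where
  "p2413 a b c d \<longleftrightarrow> c < a \<and> a < d \<and> d < b"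

definition p3142 :: "nat \<Rightarrow> nat \<Rightarrow> nat \<Rightarrow> nat \<Rightarrow> bool" where
  "p3142 a b c d \<longleftrightarrow> b < d \<and> d < a \<and> a < c"

definition p4213 :: "nat \<Rightarrow> nat \<Rightarrow> nat \<Rightarrow> nat \<Rightarrow> bool" where
  "p4213 a b c d \<longleftrightarrow> c < b \<and> b < d \<and> d < a"

definition below :: "nat list \<Rightarrow> nat list \<Rightarrow> bool" where
  "below u v \<longleftrightarrow> (\<forall>a\<in>set u. \<forall>b\<in>set v. a < b)"

fun descents :: "nat list \<Rightarrow> nat" where
  "descents (a # b # xs) = (if b < a then 1 else 0) + descents (b # xs)"
| "descents _ = 0"

text \<open>
  The flags say whether the list is preceded by a larger entry and whether it is followed by a smaller one.
\<close>

fun double_descents :: "bool \<Rightarrow> nat list \<Rightarrow> bool \<Rightarrow> nat" where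
  "double_descents l [] r = 0"
| "double_descents l [a] r = (if l \<and> r then 1 else 0)"
| "double_descents l (a # b # xs) r =
     (if l \<and> b < a then 1 else 0) + double_descents (b < a) (b # xs) r"

fun initial_run :: "nat list \<Rightarrow> nat" where
  "initial_run [] = 0"
| "initial_run [a] = 1"
| "initial_run (a # b # xs) = (if a < b then Suc (initial_run (b # xs)) else 1)"

lemma below_rev [simp]: "below (rev u) (rev v) \<longleftrightarrow> below u v"
  by (simp add: below_def)

lemma below_Nil [simp]: "below [] v" "below u []"
  by (auto simp: below_def)

lemma below_append [simp]:
  "below (u @ u') v \<longleftrightarrow> below u v \<and> below u' v"
  "below u (v @ v') \<longleftrightarrow> below u v \<and> below u v'"
  by (auto simp: below_def)

lemma below_hd_last: "below u v \<Longrightarrow> u \<noteq> [] \<Longrightarrow> v \<noteq> [] \<Longrightarrow> last u < hd v \<and> hd u < last v"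
  by (simp add: below_def)

lemma descents_append:
  assumes "u \<noteq> []" "v \<noteq> []"
  shows "descents (u @ v) = descents u + (if hd v < last u then 1 else 0) + descents v"
proof -
  obtain b w where v: "v = b # w" using assms(2) by (cases v) auto
  show ?thesis using assms(1) unfolding v
    by (induction u rule: descents.induct) auto
qed

lemma double_descents_append:
  assumes "u \<noteq> []" "v \<noteq> []"
  shows "double_descents l (u @ v) r
    = double_descents l u (hd v < last u) + double_descents (hd v < last u) v r"
proof -
  obtain b w where v: "v = b # w" using assms(2) by (cases v) auto
  show ?thesis using assms(1) unfolding v
    by (induction l u r rule: double_descents.induct) auto
qed

lemma initial_run_append_descent:
  assumes "u \<noteq> []" "v \<noteq> []" "hd v < last u"
  shows "initial_run (u @ v) = initial_run u"
proof -
  obtain b w where v: "v = b # w" using assms(2) by (cases v) auto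
  show ?thesis using assms(1,3) unfolding v
    by (induction u rule: initial_run.induct) auto
qed

text \<open>
  A list whose last entry is smaller than its first one has a descent, so its initial run ends before
  anything appended.
\<close>

lemma initial_run_append_of_last_less_hd:
  assumes "u \<noteq> []" "last u < hd u"
  shows "initial_run (u @ v) = initial_run u"
  using assms
proof (induction u rule: initial_run.induct)
  case (3 a b xs)
  then show ?case by (cases "a < b") (auto split: if_splits)
qed auto

lemma
  assumes "\<And>a b. a \<in> set xs \<Longrightarrow> b \<in> set xs \<Longrightarrow> f a < f b \<longleftrightarrow> a < b"
  shows descents_map: "descents (map f xs) = descents xs"
    and double_descents_map: "double_descents l (map f xs) r = double_descents l xs r"
    and initial_run_map: "initial_run (map f xs) = initial_run xs"
proof -
  show "descents (map f xs) = descents xs"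
    using assms by (induction xs rule: descents.induct) auto
  show "double_descents l (map f xs) r = double_descents l xs r"
    using assms by (induction l xs r rule: double_descents.induct) auto
  show "initial_run (map f xs) = initial_run xs"
    using assms by (induction xs rule: initial_run.induct) auto
qed

lemma ex_append_split:
  "(\<exists>ys zs. [] = ys @ zs \<and> P ys zs) \<longleftrightarrow> P [] []"
  "(\<exists>ys zs. x # xs = ys @ zs \<and> P ys zs)
     \<longleftrightarrow> P [] (x # xs) \<or> (\<exists>ys zs. xs = ys @ zs \<and> P (x # ys) zs)"
proof -
  show "(\<exists>ys zs. [] = ys @ zs \<and> P ys zs) \<longleftrightarrow> P [] []"
    by simp
  show "(\<exists>ys zs. x # xs = ys @ zs \<and> P ys zs)
     \<longleftrightarrow> P [] (x # xs) \<or> (\<exists>ys zs. xs = ys @ zs \<and> P (x # ys) zs)"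
    unfolding Cons_eq_append_conv by blast
qed

lemma subseq_append_expand:
  "subseq [a, b] (u @ v) \<longleftrightarrow> subseq [a, b] u \<or> a \<in> set u \<and> b \<in> set v \<or> subseq [a, b] v"
  "subseq [a, b, c] (u @ v) \<longleftrightarrow> subseq [a, b, c] u \<or> subseq [a, b] u \<and> c \<in> set v
     \<or> a \<in> set u \<and> subseq [b, c] v \<or> subseq [a, b, c] v"
  "subseq [a, b, c, d] (u @ v) \<longleftrightarrow> subseq [a, b, c, d] u \<or> subseq [a, b, c] u \<and> d \<in> set v
     \<or> subseq [a, b] u \<and> subseq [c, d] v \<or> a \<in> set u \<and> subseq [b, c, d] v
     \<or> subseq [a, b, c, d] v"
  unfolding subseq_append_iff ex_append_split subseq_singleton_left by (simp; blast)+

lemma subseq_Cons_expand: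
  "subseq (a # xs) (m # v) \<longleftrightarrow> a = m \<and> subseq xs v \<or> subseq (a # xs) v"
  by (metis subseq_Cons2_iff subseq_Cons2_neq subseq_Cons' list_emb_Cons)

lemma subseq_set: "subseq xs ys \<Longrightarrow> set xs \<subseteq> set ys"
  by (induction rule: list_emb.induct) auto

lemma subseq_rev: "subseq xs ys \<Longrightarrow> subseq (rev xs) (rev ys)"
  by (induction rule: list_emb.induct) (simp_all add: list_emb_append_mono subseq_rev_drop_many)

lemma subseq_map_conv: "subseq xs (map f ys) \<longleftrightarrow> (\<exists>zs. subseq zs ys \<and> xs = map f zs)"
  by (auto simp: subseq_conv_nths nths_map)

lemma avoids_rev:
  assumes "\<And>a b c d. R' a b c d \<longleftrightarrow> R d c b a"
  shows "avoids R (rev xs) \<longleftrightarrow> avoids R' xs"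
proof -
  have "subseq [a, b, c, d] (rev xs) \<longleftrightarrow> subseq [d, c, b, a] xs" for a b c d
    using subseq_rev[of "[a, b, c, d]" "rev xs"] subseq_rev[of "[d, c, b, a]" xs] by auto
  then show ?thesis unfolding avoids_def assms by blast
qed

text \<open>
  The map \<open>f\<close> may be increasing, with \<open>R' = R\<close>, or decreasing, when \<open>R'\<close> is the complement of \<open>R\<close>.
\<close>

lemma avoids_map:
  assumes "\<And>a b c d. {a, b, c, d} \<subseteq> set xs \<Longrightarrow> R (f a) (f b) (f c) (f d) \<longleftrightarrow> R' a b c d"
  shows "avoids R (map f xs) \<longleftrightarrow> avoids R' xs"
proof -
  have "avoids R (map f xs) \<longleftrightarrow>
    (\<forall>a b c d. subseq [a, b, c, d] xs \<longrightarrow> \<not> R (f a) (f b) (f c) (f d))"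
    unfolding avoids_def subseq_map_conv Cons_eq_map_conv by (fastforce intro!: exI)
  also have "\<dots> \<longleftrightarrow> avoids R' xs"
    unfolding avoids_def using assms subseq_set[of "[_, _, _, _]" xs] by auto
  finally show ?thesis .
qed

section \<open>Generating functions of direct and skew sums\<close>

definition gf :: "(nat list \<Rightarrow> bool) \<Rightarrow> (nat list \<Rightarrow> 'a::comm_ring_1) \<Rightarrow> 'a fps" where
  "gf P f = Abs_fps (\<lambda>n. \<Sum>xs | xs \<in> permutations_of_set {1..n} \<and> P xs. f xs)"

lemma gf_nth: "fps_nth (gf P f) n = (\<Sum>xs | xs \<in> permutations_of_set {1..n} \<and> P xs. f xs)"
  by (simp add: gf_def)

lemma gf_disjoint_union:
  assumes "\<And>xs. distinct xs \<Longrightarrow> E xs \<longleftrightarrow> P xs \<or> Q xs" "\<And>xs. P xs \<Longrightarrow> \<not> Q xs"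
  shows "gf E f = gf P f + gf Q f"
proof (rule fps_ext)
  fix n
  have "{xs. xs \<in> permutations_of_set {1..n} \<and> E xs}
    = {xs. xs \<in> permutations_of_set {1..n} \<and> P xs} \<union> {xs. xs \<in> permutations_of_set {1..n} \<and> Q xs}"
    using assms by (auto simp: permutations_of_set_def)
  then show "fps_nth (gf E f) n = fps_nth (gf P f + gf Q f) n"
    unfolding gf_nth fps_add_nth using assms(2) by (subst sum.union_disjoint[symmetric]) auto
qed

lemma gf_add: "gf P (\<lambda>xs. f xs + g xs) = gf P f + gf P g"
  by (rule fps_ext) (simp add: gf_nth sum.distrib)

lemma gf_scale: "gf P (\<lambda>xs. c * f xs) = fps_const c * gf P f"
  by (rule fps_ext) (simp add: gf_nth sum_distrib_left)

lemma gf_rev: "gf P f = gf (\<lambda>xs. P (rev xs)) (\<lambda>xs. f (rev xs))"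
  unfolding gf_def
  by (intro arg_cong[where f = Abs_fps] ext sum.reindex_bij_witness[where i = rev and j = rev])
    (auto simp: permutations_of_set_def)

lemma gf_reverse_complement:
  assumes "\<And>n xs. xs \<in> permutations_of_set {1..n} \<Longrightarrow>
    P (map (\<lambda>x. Suc n - x) (rev xs)) \<longleftrightarrow> P xs"
    and "\<And>n xs. xs \<in> permutations_of_set {1..n} \<Longrightarrow> P xs \<Longrightarrow>
      g (map (\<lambda>x. Suc n - x) (rev xs)) = f xs"
  shows "gf P f = gf P g"
proof (rule fps_ext)
  fix n
  let ?r = "\<lambda>xs. map (\<lambda>x. Suc n - x) (rev xs)"
  have inv: "?r (?r xs) = xs" if "xs \<in> permutations_of_set {1..n}" for xs
    using that by (auto simp: permutations_of_set_def rev_map[symmetric] intro!: map_idI)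
  have mem: "?r xs \<in> permutations_of_set {1..n}" if xs: "xs \<in> permutations_of_set {1..n}" for xs
  proof -
    have "inj_on (\<lambda>x. Suc n - x) {1..n}" by (auto simp: inj_on_def)
    moreover have "(\<lambda>x. Suc n - x) ` {1..n} = {1..n}"
      using calculation by (intro endo_inj_surj) auto
    ultimately show ?thesis using xs by (auto simp: permutations_of_set_def distinct_map)
  qed
  show "fps_nth (gf P f) n = fps_nth (gf P g) n"
    unfolding gf_nth
    by (rule sum.reindex_bij_witness[where i = ?r and j = ?r]) (use inv mem assms in auto)
qed

lemma initial_segment_of_below:
  assumes "set u \<union> set v = {1..n}" "below u v" "distinct u"
  shows "set u = {1..length u} \<and> set v = {Suc (length u)..n}"
proof (cases "u = []")
  case False
  define m where "m = Max (set u)"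
  have m: "m \<in> set u" "\<And>x. x \<in> set u \<Longrightarrow> x \<le> m" using False by (auto simp: m_def)
  have "set u = {1..m}"
  proof (intro equalityI subsetI)
    fix x assume "x \<in> set u"
    then show "x \<in> {1..m}" using m assms(1) by auto
  next
    fix x assume "x \<in> {1..m}"
    moreover have "m \<le> n" using m assms(1) by auto
    ultimately have "x \<in> set u \<union> set v" using assms(1) by auto
    moreover have "x \<notin> set v" using m(1) \<open>x \<in> {1..m}\<close> assms(2) by (force simp: below_def)
    ultimately show "x \<in> set u" by auto
  qed
  moreover from this have "length u = m" using distinct_card[OF assms(3)] by simp
  ultimately have u: "set u = {1..length u}" by simp
  have "set u \<inter> set v = {}" using assms(2) by (force simp: below_def)
  then have "set v = {1..n} - {1..length u}" using assms(1) u by blast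
  then show ?thesis using u by auto
qed (use assms in auto)

text \<open>
  The lower block \<open>u\<close> of \<open>u @ v\<close> is a permutation of an initial segment \<open>{1..k}\<close>, and the upper block \<open>v\<close> a
  permutation of \<open>{1..n - k}\<close> shifted by \<open>k\<close>; this is why \<open>Q\<close> and \<open>h\<close> have to be invariant under shifts.
  As the decomposition is unique, the coefficients are convolved.
\<close>

lemma gf_direct_sum:
  assumes dec: "\<And>xs. distinct xs \<Longrightarrow> E xs \<Longrightarrow> \<exists>u v. xs = u @ v \<and> below u v \<and> P u \<and> Q v"
    and comp: "\<And>u v. distinct (u @ v) \<Longrightarrow> below u v \<Longrightarrow> P u \<Longrightarrow> Q v \<Longrightarrow>
      E (u @ v) \<and> f (u @ v) = g u * h v"
    and uniq: "\<And>u v u' v'. distinct (u @ v) \<Longrightarrow> u @ v = u' @ v' \<Longrightarrow> below u v \<Longrightarrow>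
      below u' v' \<Longrightarrow> P u \<Longrightarrow> Q v \<Longrightarrow> P u' \<Longrightarrow> Q v' \<Longrightarrow> u = u'"
    and shift: "\<And>k v. Q (map ((+) k) v) \<longleftrightarrow> Q v" "\<And>k v. h (map ((+) k) v) = h v"
  shows "gf E f = gf P g * gf Q h"
proof (rule fps_ext)
  fix n
  let ?A = "{xs. xs \<in> permutations_of_set {1..n} \<and> E xs}"
  let ?P = "\<lambda>k. {u. u \<in> permutations_of_set {1..k} \<and> P u}"
  let ?Q = "\<lambda>k. {v. v \<in> permutations_of_set {1..n - k} \<and> Q v}"
  let ?S = "SIGMA k:{0..n}. ?P k \<times> ?Q k"
  let ?c = "\<lambda>(k, u, v). u @ map ((+) k) v"
  have S: "k = length u \<and> k \<le> n \<and> below u (map ((+) k) v) \<and> distinct (u @ map ((+) k) v) \<and>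
      P u \<and> Q (map ((+) k) v) \<and> set (u @ map ((+) k) v) = {1..n}" if "(k, u, v) \<in> ?S" for k u v
  proof -
    have "{1..k} \<union> (+) k ` {1..n - k} = {1..n}" if "k \<le> n"
      using that by (auto simp: image_add_atLeastAtMost)
    with that show ?thesis
      by (auto simp: permutations_of_set_def below_def distinct_map shift dest!: distinct_card)
  qed
  have inj: "inj_on ?c ?S"
  proof (rule inj_onI)
    fix p q assume pq: "p \<in> ?S" "q \<in> ?S" "?c p = ?c q"
    obtain k u v where p: "p = (k, u, v)" by (cases p)
    obtain k' u' v' where q: "q = (k', u', v')" by (cases q)
    have 1: "(k, u, v) \<in> ?S" and 2: "(k', u', v') \<in> ?S"
      and eq: "u @ map ((+) k) v = u' @ map ((+) k') v'"
      using pq unfolding p q by simp_all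
    have "u = u'" using uniq[OF _ eq] S[OF 1] S[OF 2] by blast
    moreover from this have "k = k'" using S[OF 1] S[OF 2] by auto
    ultimately show "p = q" using eq unfolding p q by (auto simp: inj_map_eq_map)
  qed
  have img: "?c ` ?S = ?A"
  proof (intro equalityI subsetI)
    fix xs assume "xs \<in> ?c ` ?S"
    then obtain k u v where *: "(k, u, v) \<in> ?S" "xs = u @ map ((+) k) v" by auto
    show "xs \<in> ?A" using S[OF *(1)] comp[of u "map ((+) k) v"] *(2)
      by (auto simp: permutations_of_set_def)
  next
    fix xs assume xs: "xs \<in> ?A"
    then have "distinct xs" "set xs = {1..n}" by (auto simp: permutations_of_set_def)
    with dec xs obtain u v where uv: "xs = u @ v" "below u v" "P u" "Q v" by blast
    define k where "k = length u"
    have sets: "set u = {1..k}" "set v = {Suc k..n}"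
      using initial_segment_of_below[of u v n] uv \<open>distinct xs\<close> \<open>set xs = {1..n}\<close>
      by (auto simp: k_def)
    have "k \<le> n"
      using sets(1) uv(1) \<open>set xs = {1..n}\<close> by (cases "k = 0") auto
    define w where "w = map (\<lambda>x. x - k) v"
    have v: "v = map ((+) k) w"
      unfolding w_def map_map using sets(2) by (intro map_idI[symmetric]) auto
    have "{Suc k..n} = (+) k ` {1..n - k}" using \<open>k \<le> n\<close> by (simp add: image_add_atLeastAtMost)
    then have "(\<lambda>x. x - k) ` {Suc k..n} = {1..n - k}" by (simp only: image_image) simp
    then have "set w = {1..n - k}" using sets(2) by (simp add: w_def)
    moreover have "distinct w" using v uv(1) \<open>distinct xs\<close> by (auto simp: distinct_map)
    ultimately have "(k, u, w) \<in> ?S"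
      using sets(1) uv v \<open>distinct xs\<close> \<open>k \<le> n\<close> shift by (auto simp: permutations_of_set_def)
    then show "xs \<in> ?c ` ?S" using uv(1) v by force
  qed
  have "fps_nth (gf E f) n = sum f (?c ` ?S)" by (simp only: gf_nth img)
  also have "\<dots> = (\<Sum>p\<in>?S. f (?c p))" by (rule sum.reindex[OF inj, unfolded comp_def])
  also have "\<dots> = (\<Sum>(k, u, v)\<in>?S. g u * h v)"
  proof (rule sum.cong[OF refl])
    fix p assume p: "p \<in> ?S"
    obtain k u v where kuv: "p = (k, u, v)" by (cases p)
    have 1: "(k, u, v) \<in> ?S" using p unfolding kuv .
    have "f (u @ map ((+) k) v) = g u * h (map ((+) k) v)"
      using S[OF 1] comp[of u "map ((+) k) v"] by blast
    then show "f (?c p) = (case p of (k, u, v) \<Rightarrow> g u * h v)" by (simp add: kuv shift)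
  qed
  also have "\<dots> = (\<Sum>k=0..n. \<Sum>(u, v)\<in>?P k \<times> ?Q k. g u * h v)"
    by (rule sum.Sigma[symmetric]) auto
  also have "\<dots> = (\<Sum>k=0..n. sum g (?P k) * sum h (?Q k))"
    by (intro sum.cong refl) (simp only: sum_product sum.cartesian_product)
  also have "\<dots> = fps_nth (gf P g * gf Q h) n"
    by (simp add: fps_mult_nth gf_nth)
  finally show "fps_nth (gf E f) n = fps_nth (gf P g * gf Q h) n" .
qed

text \<open>
  Reversal exchanges direct and skew sums.
\<close>

lemma gf_skew_sum:
  assumes dec: "\<And>xs. distinct xs \<Longrightarrow> E xs \<Longrightarrow> \<exists>u v. xs = u @ v \<and> below v u \<and> P u \<and> Q v"
    and comp: "\<And>u v. distinct (u @ v) \<Longrightarrow> below v u \<Longrightarrow> P u \<Longrightarrow> Q v \<Longrightarrow>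
      E (u @ v) \<and> f (u @ v) = g u * h v"
    and uniq: "\<And>u v u' v'. distinct (u @ v) \<Longrightarrow> u @ v = u' @ v' \<Longrightarrow> below v u \<Longrightarrow>
      below v' u' \<Longrightarrow> P u \<Longrightarrow> Q v \<Longrightarrow> P u' \<Longrightarrow> Q v' \<Longrightarrow> u = u'"
    and shift: "\<And>k v. P (map ((+) k) v) \<longleftrightarrow> P v" "\<And>k v. g (map ((+) k) v) = g v"
  shows "gf E f = gf P g * gf Q h"
proof -
  have "gf (\<lambda>xs. E (rev xs)) (\<lambda>xs. f (rev xs))
    = gf (\<lambda>xs. Q (rev xs)) (\<lambda>xs. h (rev xs)) * gf (\<lambda>xs. P (rev xs)) (\<lambda>xs. g (rev xs))"
  proof (rule gf_direct_sum)
    fix xs :: "nat list" assume "distinct xs" "E (rev xs)"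
    then obtain u v where uv: "rev xs = u @ v" "below v u" "P u" "Q v" using dec[of "rev xs"] by auto
    then have "xs = rev v @ rev u" by (metis rev_append rev_rev_ident)
    with uv show "\<exists>u v. xs = u @ v \<and> below u v \<and> Q (rev u) \<and> P (rev v)"
      by (intro exI[of _ "rev v"] exI[of _ "rev u"]) simp
  next
    fix u v :: "nat list" assume "distinct (u @ v)" "below u v" "Q (rev u)" "P (rev v)"
    then show "E (rev (u @ v)) \<and> f (rev (u @ v)) = h (rev u) * g (rev v)"
      using comp[of "rev v" "rev u"] by (auto simp: mult.commute)
  next
    fix u v u' v' :: "nat list"
    assume *: "distinct (u @ v)" "u @ v = u' @ v'" "below u v" "below u' v'" "Q (rev u)" "P (rev v)"
      "Q (rev u')" "P (rev v')"
    have "rev v @ rev u = rev v' @ rev u'" using *(2) by (metis rev_append)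
    then have "rev v = rev v'" using uniq[of "rev v" "rev u" "rev v'" "rev u'"] * by auto
    then show "u = u'" using *(2) by simp
  qed (simp_all add: rev_map shift)
  then show ?thesis
    unfolding gf_rev[of E f] gf_rev[of P g] gf_rev[of Q h] by (simp add: mult.commute)
qed

definition singleton :: "nat list \<Rightarrow> bool" where
  "singleton xs \<longleftrightarrow> (\<exists>a. xs = [a])"

lemma gf_singleton: "gf singleton f = fps_const (f [1]) * fps_X"
proof (rule fps_ext)
  fix n
  have "{xs. xs \<in> permutations_of_set {1..n} \<and> singleton xs} = (if n = 1 then {[1]} else {})"
  proof -
    have only: "xs = [1] \<and> n = 1" if "set xs = {1..n}" "singleton xs" for xs
      using that by (metis atLeastAtMost_singleton_iff list.set(1,2) singleton_def)
    have "[1::nat] \<in> permutations_of_set {1..1} \<and> singleton [1]"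
      by (auto simp: singleton_def permutations_of_set_def)
    then show ?thesis
      by (auto simp del: One_nat_def dest!: only dest: permutations_of_setD)
  qed
  then show "fps_nth (gf singleton f) n = fps_nth (fps_const (f [1]) * fps_X) n"
    by (simp add: gf_nth)
qed

section \<open>Separable permutations\<close>

lemma subseq_mem:
  "subseq [a, b] xs \<Longrightarrow> a \<in> set xs \<and> b \<in> set xs"
  "subseq [a, b, c] xs \<Longrightarrow> a \<in> set xs \<and> b \<in> set xs \<and> c \<in> set xs"
  "subseq [a, b, c, d] xs \<Longrightarrow> a \<in> set xs \<and> b \<in> set xs \<and> c \<in> set xs \<and> d \<in> set xs"
  by (auto dest!: subseq_set)

lemma avoids_append:
  "avoids R (u @ v) \<longleftrightarrow> avoids R u \<and> avoids R v
    \<and> (\<forall>a b c d. subseq [a, b, c] u \<longrightarrow> d \<in> set v \<longrightarrow> \<not> R a b c d)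
    \<and> (\<forall>a b c d. subseq [a, b] u \<longrightarrow> subseq [c, d] v \<longrightarrow> \<not> R a b c d)
    \<and> (\<forall>a b c d. a \<in> set u \<longrightarrow> subseq [b, c, d] v \<longrightarrow> \<not> R a b c d)"
  unfolding avoids_def subseq_append_expand by blast

definition wt :: "'a::comm_ring_1 \<Rightarrow> 'a \<Rightarrow> 'a \<Rightarrow> bool \<Rightarrow> bool \<Rightarrow> nat list \<Rightarrow> 'a" where
  "wt t x y l r xs = t ^ descents xs * x ^ double_descents l xs r * y ^ initial_run xs"

lemma wt_shift [simp]: "wt t x y l r (map ((+) k) xs) = wt t x y l r xs"
  by (simp add: wt_def descents_map double_descents_map initial_run_map)

lemma wt_singleton: "wt t x y l r [a] = (if l \<and> r then x else 1) * y"
  by (simp add: wt_def)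

lemma wt_ascent:
  assumes "u \<noteq> []" "v \<noteq> []" "last u < hd v"
  shows "wt t x 1 l r (u @ v) = wt t x 1 l False u * wt t x 1 False r v"
  using assms by (simp add: wt_def descents_append double_descents_append power_add)

lemma wt_ascent_of_descending:
  assumes "u \<noteq> []" "v \<noteq> []" "last u < hd v" "last u < hd u"
  shows "wt t x y l r (u @ v) = wt t x y l False u * wt t x 1 False r v"
  using assms
  by (simp add: wt_def descents_append double_descents_append power_add
      initial_run_append_of_last_less_hd)

lemma wt_descent:
  assumes "u \<noteq> []" "v \<noteq> []" "hd v < last u"
  shows "wt t x y l r (u @ v) = t * wt t x y l True u * wt t x 1 True r v"
  using assms
  by (simp add: wt_def descents_append double_descents_append power_add
      initial_run_append_descent)

lemma wt_Cons_ascent: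
  assumes "v \<noteq> []" "a < hd v"
  shows "wt t x y False r (a # v) = y * wt t x y False r v"
  using assms by (cases v) (simp_all add: wt_def)

definition separable :: "nat list \<Rightarrow> bool" where
  "separable xs \<longleftrightarrow> avoids p2413 xs \<and> avoids p3142 xs"

lemma separable_shift [simp]: "separable (map ((+) k) xs) \<longleftrightarrow> separable xs"
  unfolding separable_def by (simp add: avoids_map[where R' = p2413] avoids_map[where R' = p3142] p2413_def p3142_def)

lemma separable_rev [simp]: "separable (rev xs) \<longleftrightarrow> separable xs"
proof -
  have "avoids p2413 (rev xs) = avoids p3142 xs" "avoids p3142 (rev xs) = avoids p2413 xs"
    by (rule avoids_rev; auto simp: p2413_def p3142_def)+
  then show ?thesis by (auto simp: separable_def)
qed

lemma separable_direct_sum: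
  assumes "below u v"
  shows "separable (u @ v) \<longleftrightarrow> separable u \<and> separable v"
proof -
  have lt: "\<And>a b. a \<in> set u \<Longrightarrow> b \<in> set v \<Longrightarrow> a < b" using assms by (auto simp: below_def)
  have "avoids p2413 (u @ v) \<longleftrightarrow> avoids p2413 u \<and> avoids p2413 v"
    unfolding avoids_append p2413_def by (auto dest!: subseq_mem) (meson lt less_asym less_trans)+
  moreover have "avoids p3142 (u @ v) \<longleftrightarrow> avoids p3142 u \<and> avoids p3142 v"
    unfolding avoids_append p3142_def by (auto dest!: subseq_mem) (meson lt less_asym less_trans)+
  ultimately show ?thesis by (auto simp: separable_def)
qed

lemma separable_skew_sum:
  assumes "below v u"
  shows "separable (u @ v) \<longleftrightarrow> separable u \<and> separable v"
  using separable_direct_sum[of "rev v" "rev u"] assms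
  by (simp flip: rev_append add: conj_commute)

text \<open>
  Cut after the last entry \<open>p\<close> that is at most the first entry \<open>h\<close>. Everything behind the cut exceeds \<open>h\<close>;
  an entry \<open>a\<close> in front of the cut exceeding an entry \<open>b\<close> behind it would give the pattern 2413 in
  \<open>h, a, p, b\<close>.
\<close>

lemma separable_decomposes_as_direct_sum:
  assumes "separable xs" "distinct xs" "xs \<noteq> []" "hd xs < last xs"
  shows "\<exists>u v. xs = u @ v \<and> u \<noteq> [] \<and> v \<noteq> [] \<and> below u v"
proof -
  obtain ys p zs where xs: "xs = ys @ p # zs" and p: "p \<le> hd xs" and zs: "\<forall>z\<in>set zs. \<not> z \<le> hd xs"
    using split_list_last_prop[of xs "\<lambda>z. z \<le> hd xs"] assms(3) by (metis hd_in_set order_refl)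
  have "zs \<noteq> []" using p assms(4) xs by auto
  have "a < b" if a: "a \<in> set (ys @ [p])" and b: "b \<in> set zs" for a b
  proof (rule ccontr)
    assume "\<not> a < b"
    moreover have "a \<noteq> b" using a b assms(2) xs by auto
    ultimately have "b < a" by simp
    have "hd xs < b" using b zs by force
    then have "a \<noteq> p" "a \<noteq> hd xs" using p \<open>b < a\<close> by auto
    then have "a \<in> set ys" using a by auto
    then obtain h ys' where ys: "ys = h # ys'" by (cases ys) auto
    then have h: "hd xs = h" "a \<in> set ys'" using xs \<open>a \<in> set ys\<close> \<open>a \<noteq> hd xs\<close> by auto
    have "p \<noteq> h" using assms(2) xs ys by auto
    then have "p2413 h a p b" using p h(1) \<open>hd xs < b\<close> \<open>b < a\<close> by (auto simp: p2413_def)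
    moreover have "subseq ([a] @ [p, b]) (ys' @ p # zs)"
      by (rule list_emb_append_mono) (use h b in \<open>auto simp: subseq_singleton_left\<close>)
    then have "subseq [h, a, p, b] xs" unfolding xs ys by simp
    ultimately show False using assms(1) by (auto simp: separable_def avoids_def)
  qed
  then have "below (ys @ [p]) zs" by (auto simp: below_def)
  with \<open>zs \<noteq> []\<close> xs show ?thesis by (intro exI[of _ "ys @ [p]"] exI[of _ zs]) auto
qed

text \<open>
  By \<open>separable_decomposes_as_direct_sum\<close>, the condition \<open>last u \<le> hd u\<close> expresses that \<open>u\<close> is not a direct
  sum. The same comparison of the end entries replaces indecomposability in all that follows.
\<close>

lemma separable_first_component:
  assumes "separable xs" "distinct xs" "xs \<noteq> []"
  shows "\<exists>u v. xs = u @ v \<and> u \<noteq> [] \<and> last u \<le> hd u \<and> below u v"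
  using assms
proof (induction "length xs" arbitrary: xs rule: less_induct)
  case less
  show ?case
  proof (cases "last xs \<le> hd xs")
    case True
    then show ?thesis using less.prems by (intro exI[of _ xs] exI[of _ "[]"]) auto
  next
    case False
    then obtain u v where uv: "xs = u @ v" "u \<noteq> []" "v \<noteq> []" "below u v"
      using separable_decomposes_as_direct_sum[of xs] less.prems by auto
    then obtain u1 u2 where u: "u = u1 @ u2" "u1 \<noteq> []" "last u1 \<le> hd u1" "below u1 u2"
      using less.hyps[of u] less.prems separable_direct_sum[of u v] by auto
    with uv show ?thesis by (intro exI[of _ u1] exI[of _ "u2 @ v"]) auto
  qed
qed

lemma separable_last_component:
  assumes "separable xs" "distinct xs" "xs \<noteq> []"
  shows "\<exists>u v. xs = u @ v \<and> v \<noteq> [] \<and> last v \<le> hd v \<and> below u v"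
  using assms
proof (induction "length xs" arbitrary: xs rule: less_induct)
  case less
  show ?case
  proof (cases "last xs \<le> hd xs")
    case True
    then show ?thesis using less.prems by (intro exI[of _ "[]"] exI[of _ xs]) auto
  next
    case False
    then obtain u v where uv: "xs = u @ v" "u \<noteq> []" "v \<noteq> []" "below u v"
      using separable_decomposes_as_direct_sum[of xs] less.prems by auto
    then obtain v1 v2 where v: "v = v1 @ v2" "v2 \<noteq> []" "last v2 \<le> hd v2" "below v1 v2"
      using less.hyps[of v] less.prems separable_direct_sum[of u v] by auto
    with uv show ?thesis by (intro exI[of _ "u @ v1"] exI[of _ v2]) auto
  qed
qed

lemma separable_last_skew_component:
  assumes "separable xs" "distinct xs" "xs \<noteq> []"
  shows "\<exists>u v. xs = u @ v \<and> v \<noteq> [] \<and> hd v \<le> last v \<and> below v u"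
proof -
  obtain u v where *: "rev xs = u @ v" "u \<noteq> []" "last u \<le> hd u" "below u v"
    using separable_first_component[of "rev xs"] assms by auto
  then have "xs = rev v @ rev u" by (metis rev_append rev_rev_ident)
  with * show ?thesis
    by (intro exI[of _ "rev v"] exI[of _ "rev u"]) (auto simp: hd_rev last_rev)
qed

text \<open>
  If one of the two components were a proper prefix of the other, then the latter would be a direct sum
  and its last entry would exceed its first one.
\<close>

lemma first_component_unique:
  assumes "u @ v = u' @ v'" "below u v" "below u' v'" "u \<noteq> []" "u' \<noteq> []"
    "last u \<le> hd u" "last u' \<le> hd u'"
  shows "u = u'"
proof -
  have *: False if "u' = u @ w" "v = w @ v'" "w \<noteq> []" "below u v" "u \<noteq> []" "last u' \<le> hd u'"
    for u v u' v' w :: "nat list"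
  proof -
    have "hd u < last w" using that by (auto simp: below_def)
    then show False using that by auto
  qed
  show ?thesis using assms(1) unfolding append_eq_append_conv2
    by (elim exE) (metis * assms(2-7) append.right_neutral)
qed

lemma last_component_unique:
  assumes "u @ v = u' @ v'" "below u v" "below u' v'" "v \<noteq> []" "v' \<noteq> []"
    "last v \<le> hd v" "last v' \<le> hd v'"
  shows "u = u'"
proof -
  have *: False if "u' = u @ w" "v = w @ v'" "w \<noteq> []" "below u' v'" "v' \<noteq> []" "last v \<le> hd v"
    for u v u' v' w :: "nat list"
  proof -
    have "hd w < last v'" using that by (auto simp: below_def)
    then show False using that by auto
  qed
  show ?thesis using assms(1) unfolding append_eq_append_conv2
    by (elim exE) (metis * assms(2-7) append.right_neutral)
qed

lemma last_skew_component_unique: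
  assumes "u @ v = u' @ v'" "below v u" "below v' u'" "v \<noteq> []" "v' \<noteq> []"
    "hd v \<le> last v" "hd v' \<le> last v'"
  shows "u = u'"
proof -
  have "rev v @ rev u = rev v' @ rev u'" using assms(1) by (metis rev_append)
  then have "rev v = rev v'"
    using assms by (intro first_component_unique[of "rev v" "rev u" "rev v'" "rev u'"])
      (auto simp: hd_rev last_rev)
  then show ?thesis using assms(1) by simp
qed

text \<open>
  With \<open>R\<close> one of \<open>>\<close>, \<open><\<close>, \<open>\<ge>\<close>, \<open>\<le>\<close> these are the separable lists that are skew sums, direct sums,
  not direct sums, not skew sums; with \<open>R\<close> always true, all nonempty separable lists.
\<close>

definition separable_ends :: "(nat \<Rightarrow> nat \<Rightarrow> bool) \<Rightarrow> nat list \<Rightarrow> bool" where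
  "separable_ends R xs \<longleftrightarrow> separable xs \<and> xs \<noteq> [] \<and> R (hd xs) (last xs)"

definition min_first :: "nat list \<Rightarrow> bool" where
  "min_first xs \<longleftrightarrow> (\<forall>z\<in>set (tl xs). hd xs < z)"

lemma separable_ends_shift [simp]:
  assumes "\<And>a b. R (k + a) (k + b) \<longleftrightarrow> R a b"
  shows "separable_ends R (map ((+) k) xs) \<longleftrightarrow> separable_ends R xs"
  using assms by (cases "xs = []") (auto simp: separable_ends_def hd_map last_map)

lemma hd_eq_last_iff_singleton:
  assumes "distinct xs" "xs \<noteq> []"
  shows "hd xs = last xs \<longleftrightarrow> singleton xs"
  using assms by (cases xs) (auto simp: singleton_def)

lemma separable_singleton: "separable [a]"
  by (auto simp: separable_def avoids_def)

text \<open>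
  Reversal together with complementation preserves descents, and a larger left neighbour becomes a
  smaller right neighbour.
\<close>

lemma
  assumes "\<And>a b. a \<in> set xs \<Longrightarrow> b \<in> set xs \<Longrightarrow> f a < f b \<longleftrightarrow> b < a"
  shows descents_rev_antimono: "descents (rev (map f xs)) = descents xs"
    and double_descents_rev_antimono:
      "double_descents l (rev (map f xs)) r = double_descents r xs l"
proof -
  show "descents (rev (map f xs)) = descents xs"
    using assms
  proof (induction xs rule: descents.induct)
    case (1 a b xs)
    then have "descents (rev (map f (b # xs))) = descents (b # xs)" by simp
    then show ?case using 1(2)[of a b]
      by (simp add: descents_append[of "rev (map f xs) @ [f b]" "[f a]", simplified])
  qed auto
  show "double_descents l (rev (map f xs)) r = double_descents r xs l"
    using assms
  proof (induction r xs l arbitrary: r rule: double_descents.induct)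
    case (3 l' a b xs r')
    then have "double_descents r' (rev (map f (b # xs))) (b < a)
      = double_descents (b < a) (b # xs) r'" by simp
    then show ?case using 3(2)[of a b]
      by (simp add: double_descents_append[of "rev (map f xs) @ [f b]" "[f a]", simplified])
  qed auto
qed

text \<open>
  Separable blocks between two larger neighbours have the same generating function as those with the
  convention \<open>\<pi>(0) = \<pi>(n + 1) = 0\<close>, by reversal and complementation.
\<close>

lemma gf_separable_pads_swap:
  "gf (separable_ends (\<lambda>_ _. True)) (wt t x 1 True False)
    = gf (separable_ends (\<lambda>_ _. True)) (wt t x 1 False True)"
proof (rule gf_reverse_complement)
  fix n and xs :: "nat list" assume "xs \<in> permutations_of_set {1..n}"
  then have set: "set xs = {1..n}" by (auto simp: permutations_of_set_def)
  let ?f = "\<lambda>x. Suc n - x"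
  have anti: "\<And>a b. a \<in> set xs \<Longrightarrow> b \<in> set xs \<Longrightarrow> ?f a < ?f b \<longleftrightarrow> b < a"
    unfolding set by auto
  have "avoids p2413 (map ?f (rev xs)) = avoids p3142 (rev xs)"
    "avoids p3142 (map ?f (rev xs)) = avoids p2413 (rev xs)"
    by (rule avoids_map; use anti in \<open>auto simp: p2413_def p3142_def\<close>)+
  then have "separable (map ?f (rev xs)) \<longleftrightarrow> separable (rev xs)" by (auto simp: separable_def)
  then show "separable_ends (\<lambda>_ _. True) (map ?f (rev xs)) \<longleftrightarrow> separable_ends (\<lambda>_ _. True) xs"
    by (simp add: separable_ends_def)
  show "wt t x 1 False True (map ?f (rev xs)) = wt t x 1 True False xs"
    using descents_rev_antimono[of xs ?f] double_descents_rev_antimono[of xs ?f] anti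
    by (simp add: wt_def rev_map)
qed

context
  fixes t x :: "'a::comm_ring_1"
begin

lemma gf_min_first:
  fixes y :: 'a
  shows "gf (\<lambda>xs. separable_ends (<) xs \<and> min_first xs) (wt t x y False True)
    = fps_const y * fps_X * gf (separable_ends (\<lambda>_ _. True)) (wt t x y False True)"
proof -
  have "gf (\<lambda>xs. separable_ends (<) xs \<and> min_first xs) (wt t x y False True)
    = gf singleton (\<lambda>_. y) * gf (separable_ends (\<lambda>_ _. True)) (wt t x y False True)"
  proof (rule gf_direct_sum)
    fix xs assume "distinct xs" and xs: "separable_ends (<) xs \<and> min_first xs"
    then obtain a v where av: "xs = [a] @ v" by (cases xs) (auto simp: separable_ends_def)
    then have "below [a] v" "v \<noteq> []"
      using xs by (auto simp: min_first_def below_def separable_ends_def)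
    moreover from this have "separable v"
      using xs av separable_direct_sum[of "[a]" v] by (simp add: separable_ends_def)
    ultimately show "\<exists>u v. xs = u @ v \<and> below u v \<and> singleton u \<and> separable_ends (\<lambda>_ _. True) v"
      using av by (intro exI[of _ "[a]"] exI[of _ v]) (simp add: singleton_def separable_ends_def)
  next
    fix u v assume uv: "below u v" "singleton u" "separable_ends (\<lambda>_ _. True) v"
    then obtain a where u: "u = [a]" by (auto simp: singleton_def)
    then show "(separable_ends (<) (u @ v) \<and> min_first (u @ v)) \<and>
      wt t x y False True (u @ v) = y * wt t x y False True v"
      using uv separable_direct_sum[of u v] wt_Cons_ascent[of v a]
      by (auto simp: separable_ends_def min_first_def separable_singleton below_def)
  qed (auto simp: singleton_def separable_ends_shift)
  then show ?thesis by (simp add: gf_singleton)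
qed

text \<open>
  The first component is not a single entry, so it is a skew sum. It contains a descent and therefore
  the whole initial run, and its last entry is followed by a larger one.
\<close>

lemma gf_not_min_first:
  fixes y :: 'a
  shows "gf (\<lambda>xs. separable_ends (<) xs \<and> \<not> min_first xs) (wt t x y False True)
    = gf (separable_ends (>)) (wt t x y False False)
      * gf (separable_ends (\<lambda>_ _. True)) (wt t x 1 False True)"
proof (rule gf_direct_sum)
  fix xs assume "distinct xs" and xs: "separable_ends (<) xs \<and> \<not> min_first xs"
  then obtain u v where uv: "xs = u @ v" "u \<noteq> []" "last u \<le> hd u" "below u v"
    using separable_first_component[of xs] by (auto simp: separable_ends_def)
  have "v \<noteq> []" using uv xs by (auto simp: separable_ends_def)
  moreover have "last u < hd u"
  proof (rule ccontr)
    assume "\<not> last u < hd u"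
    then have "singleton u"
      using hd_eq_last_iff_singleton[of u] uv \<open>distinct xs\<close> by auto
    then have "min_first xs" using uv by (auto simp: singleton_def min_first_def below_def)
    with xs show False by simp
  qed
  ultimately show "\<exists>u v. xs = u @ v \<and> below u v \<and> separable_ends (>) u \<and>
      separable_ends (\<lambda>_ _. True) v"
    using uv xs separable_direct_sum[of u v]
    by (intro exI[of _ u] exI[of _ v]) (auto simp: separable_ends_def)
next
  fix u v assume uv: "below u v" "separable_ends (>) u" "separable_ends (\<lambda>_ _. True) v"
  have "last u \<in> set (tl u)" using uv(2) by (cases u) (auto simp: separable_ends_def)
  then show "(separable_ends (<) (u @ v) \<and> \<not> min_first (u @ v)) \<and>
    wt t x y False True (u @ v) = wt t x y False False u * wt t x 1 False True v"
    using uv separable_direct_sum[of u v] below_hd_last[of u v]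
      wt_ascent_of_descending[of u v t x y False True]
    by (auto simp: separable_ends_def min_first_def intro!: bexI[of _ "last u"])
next
  fix u v u' v' assume "u @ v = u' @ v'" "below u v" "below u' v'"
    "separable_ends (>) u" "separable_ends (>) u'"
  then show "u = u'"
    using first_component_unique[of u v u' v'] by (auto simp: separable_ends_def)
qed (auto simp: separable_ends_shift)

text \<open>
  Here the last skew component is split off; the entry in front of it is larger.
\<close>

lemma gf_skew_decomposable:
  fixes y :: 'a
  shows "gf (separable_ends (>)) (wt t x y False r)
    = fps_const t * gf (separable_ends (\<lambda>_ _. True)) (wt t x y False True)
      * gf (separable_ends (\<le>)) (wt t x 1 True r)"
proof -
  have "gf (separable_ends (>)) (wt t x y False r)
    = gf (separable_ends (\<lambda>_ _. True)) (\<lambda>xs. t * wt t x y False True xs)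
      * gf (separable_ends (\<le>)) (wt t x 1 True r)"
  proof (rule gf_skew_sum)
    fix xs assume "distinct xs" and xs: "separable_ends (>) xs"
    then obtain u v where uv: "xs = u @ v" "v \<noteq> []" "hd v \<le> last v" "below v u"
      using separable_last_skew_component[of xs] by (auto simp: separable_ends_def)
    have "u \<noteq> []" using uv xs by (auto simp: separable_ends_def)
    then show "\<exists>u v. xs = u @ v \<and> below v u \<and> separable_ends (\<lambda>_ _. True) u \<and>
        separable_ends (\<le>) v"
      using uv xs separable_skew_sum[of v u]
      by (intro exI[of _ u] exI[of _ v]) (auto simp: separable_ends_def)
  next
    fix u v assume uv: "below v u" "separable_ends (\<lambda>_ _. True) u" "separable_ends (\<le>) v"
    then have "hd v < last u" "last v < hd u" by (auto simp: separable_ends_def below_def)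
    then show "separable_ends (>) (u @ v) \<and>
      wt t x y False r (u @ v) = t * wt t x y False True u * wt t x 1 True r v"
      using uv separable_skew_sum[of v u] wt_descent[of u v t x y False r]
      by (auto simp: separable_ends_def)
  next
    fix u v u' v' assume "u @ v = u' @ v'" "below v u" "below v' u'"
      "separable_ends (\<le>) v" "separable_ends (\<le>) v'"
    then show "u = u'"
      using last_skew_component_unique[of u v u' v'] by (auto simp: separable_ends_def)
  qed (auto simp: separable_ends_shift)
  then show ?thesis by (simp add: gf_scale)
qed

lemma gf_sum_decomposable:
  "gf (separable_ends (<)) (wt t x 1 True r)
    = gf (separable_ends (\<lambda>_ _. True)) (wt t x 1 True False)
      * gf (separable_ends (\<ge>)) (wt t x 1 False r)"
proof (rule gf_direct_sum)
  fix xs assume "distinct xs" and xs: "separable_ends (<) xs"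
  then obtain u v where uv: "xs = u @ v" "v \<noteq> []" "last v \<le> hd v" "below u v"
    using separable_last_component[of xs] by (auto simp: separable_ends_def)
  have "u \<noteq> []" using uv xs by (auto simp: separable_ends_def)
  then show "\<exists>u v. xs = u @ v \<and> below u v \<and> separable_ends (\<lambda>_ _. True) u \<and>
      separable_ends (\<ge>) v"
    using uv xs separable_direct_sum[of u v]
    by (intro exI[of _ u] exI[of _ v]) (auto simp: separable_ends_def)
next
  fix u v assume uv: "below u v" "separable_ends (\<lambda>_ _. True) u" "separable_ends (\<ge>) v"
  then show "separable_ends (<) (u @ v) \<and>
    wt t x 1 True r (u @ v) = wt t x 1 True False u * wt t x 1 False r v"
    using separable_direct_sum[of u v] below_hd_last[of u v] wt_ascent[of u v t x True r]
    by (auto simp: separable_ends_def)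
next
  fix u v u' v' assume "u @ v = u' @ v'" "below u v" "below u' v'"
    "separable_ends (\<ge>) v" "separable_ends (\<ge>) v'"
  then show "u = u'"
    using last_component_unique[of u v u' v'] by (auto simp: separable_ends_def)
qed (auto simp: separable_ends_shift)

lemma separable_ends_trichotomy:
  assumes "distinct xs"
  shows "separable_ends (\<lambda>_ _. True) xs \<longleftrightarrow> separable_ends (\<ge>) xs \<or> separable_ends (<) xs"
    and "separable_ends (\<ge>) xs \<longleftrightarrow> singleton xs \<or> separable_ends (>) xs"
    and "separable_ends (\<le>) xs \<longleftrightarrow> singleton xs \<or> separable_ends (<) xs"
proof -
  have "xs \<noteq> [] \<Longrightarrow> hd xs = last xs \<longleftrightarrow> singleton xs" using hd_eq_last_iff_singleton assms by blast
  moreover have "singleton xs \<Longrightarrow> separable xs \<and> xs \<noteq> []"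
    by (auto simp: singleton_def separable_singleton)
  ultimately show "separable_ends (\<lambda>_ _. True) xs \<longleftrightarrow> separable_ends (\<ge>) xs \<or> separable_ends (<) xs"
    "separable_ends (\<ge>) xs \<longleftrightarrow> singleton xs \<or> separable_ends (>) xs"
    "separable_ends (\<le>) xs \<longleftrightarrow> singleton xs \<or> separable_ends (<) xs"
    by (auto simp: separable_ends_def le_less)
qed

theorem separable_gf_equation:
  fixes y :: 'a
  defines "N \<equiv> gf (separable_ends (\<lambda>_ _. True)) (wt t x y False True)"
    and "S \<equiv> gf (separable_ends (\<lambda>_ _. True)) (wt t x 1 False True)"
  shows "N = fps_const y * fps_X * (1 + N)
    + fps_const t * N * (fps_const x * fps_X + fps_X * S + S * S)"
proof -
  have indec: "gf (separable_ends (\<ge>)) (wt t x z False r)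
      = fps_const z * fps_X + gf (separable_ends (>)) (wt t x z False r)" for z r
    by (subst gf_disjoint_union[of "separable_ends (\<ge>)" singleton "separable_ends (>)"])
      (auto simp: separable_ends_trichotomy gf_singleton wt_singleton separable_ends_def[of "(>)"]
        singleton_def)
  have skew_indec: "gf (separable_ends (\<le>)) (wt t x 1 True r)
      = fps_const (if r then x else 1) * fps_X + gf (separable_ends (<)) (wt t x 1 True r)" for r
    by (subst gf_disjoint_union[of "separable_ends (\<le>)" singleton "separable_ends (<)"])
      (auto simp: separable_ends_trichotomy gf_singleton wt_singleton separable_ends_def[of "(<)"]
        singleton_def)
  have all: "gf (separable_ends (\<lambda>_ _. True)) (wt t x z False True)
    = fps_const z * fps_X * (1 + gf (separable_ends (\<lambda>_ _. True)) (wt t x z False True))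
      + gf (separable_ends (>)) (wt t x z False True)
      + gf (separable_ends (>)) (wt t x z False False) * S" for z
  proof -
    have "gf (separable_ends (\<lambda>_ _. True)) (wt t x z False True)
      = gf (separable_ends (\<ge>)) (wt t x z False True) + gf (separable_ends (<)) (wt t x z False True)"
      by (rule gf_disjoint_union) (auto simp: separable_ends_trichotomy(1) separable_ends_def)
    also have "gf (separable_ends (<)) (wt t x z False True)
      = gf (\<lambda>xs. separable_ends (<) xs \<and> min_first xs) (wt t x z False True)
        + gf (\<lambda>xs. separable_ends (<) xs \<and> \<not> min_first xs) (wt t x z False True)"
      by (rule gf_disjoint_union) auto
    finally have eq: "gf (separable_ends (\<lambda>_ _. True)) (wt t x z False True)
      = (fps_const z * fps_X + gf (separable_ends (>)) (wt t x z False True))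
        + (fps_const z * fps_X * gf (separable_ends (\<lambda>_ _. True)) (wt t x z False True)
          + gf (separable_ends (>)) (wt t x z False False) * S)"
      unfolding indec gf_min_first gf_not_min_first S_def .
    show ?thesis by (rule trans[OF eq]) (simp add: algebra_simps)
  qed
  \<comment> \<open>\<open>I r\<close> counts the choices for the last direct component of a skew component, where \<open>r\<close> tells
    whether it ends the list. Together with the summands behind it, it forms an arbitrary separable list.\<close>
  define I where "I = (\<lambda>r. gf (separable_ends (\<ge>)) (wt t x 1 False r))"
  have S: "S = I True + I False * S"
    unfolding I_def indec
    by (rule trans[OF all[of 1, folded S_def]]) (simp add: algebra_simps)
  have J: "gf (separable_ends (\<le>)) (wt t x 1 True r)
      = fps_const (if r then x else 1) * fps_X + S * I r" for r
    unfolding skew_indec gf_sum_decomposable gf_separable_pads_swap S_def I_def ..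
  have "N = fps_const y * fps_X * (1 + N) + fps_const t * N * (fps_const x * fps_X + S * I True)
      + fps_const t * N * (fps_X + S * I False) * S"
    by (rule trans[OF all[of y, folded N_def, unfolded gf_skew_decomposable J, folded N_def]])
      simp
  also have "\<dots> = fps_const y * fps_X * (1 + N)
      + fps_const t * N * (fps_const x * fps_X + fps_X * S + S * (I True + I False * S))"
    by (simp add: algebra_simps)
  also have "I True + I False * S = S" by (rule S[symmetric])
  finally show ?thesis .
qed

end

section \<open>Permutations avoiding 2413 and 4213\<close>

definition avoids_2413_4213 :: "nat list \<Rightarrow> bool" where
  "avoids_2413_4213 xs \<longleftrightarrow> avoids p2413 xs \<and> avoids p4213 xs"

text \<open>
  A cut at \<open>c\<close> separates the values up to \<open>c\<close> from the values above \<open>c\<close>. It is admissible if an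
  entry with value between these two groups, put in front of \<open>xs\<close>, starts neither a 2413 nor a 4213.
\<close>

definition cut_ok :: "nat \<Rightarrow> nat list \<Rightarrow> bool" where
  "cut_ok c xs \<longleftrightarrow> (\<forall>d a b. subseq [d, a, b] xs \<longrightarrow>
     \<not> (a \<le> c \<and> c < b \<and> b < d) \<and> \<not> (a < d \<and> d < b \<and> b \<le> c))"

text \<open>
  A cut right above an entry is represented by this entry. The cut below all entries is always
  admissible and is left out.
\<close>

definition cuts :: "nat list \<Rightarrow> nat set" where
  "cuts xs = {c \<in> set xs. cut_ok c xs}"

lemma finite_cuts [simp]: "finite (cuts xs)"
  by (simp add: cuts_def)

lemma cut_ok_map:
  assumes "\<And>a b. a \<in> set xs \<Longrightarrow> b \<in> set xs \<Longrightarrow> f a < f b \<longleftrightarrow> a < b"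
    and "\<And>a. a \<in> set xs \<Longrightarrow> f a \<le> c' \<longleftrightarrow> a \<le> c"
  shows "cut_ok c' (map f xs) \<longleftrightarrow> cut_ok c xs"
proof -
  have "cut_ok c' (map f xs) \<longleftrightarrow> (\<forall>d a b. subseq [d, a, b] xs \<longrightarrow>
     \<not> (f a \<le> c' \<and> c' < f b \<and> f b < f d) \<and> \<not> (f a < f d \<and> f d < f b \<and> f b \<le> c'))"
    unfolding cut_ok_def subseq_map_conv Cons_eq_map_conv by (fastforce intro!: exI)
  also have "\<dots> \<longleftrightarrow> cut_ok c xs"
    unfolding cut_ok_def
  proof (intro all_cong1 imp_cong refl)
    fix d a b assume "subseq [d, a, b] xs"
    then have "a \<in> set xs" "b \<in> set xs" "d \<in> set xs" by (auto dest: subseq_mem)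
    then show "(\<not> (f a \<le> c' \<and> c' < f b \<and> f b < f d) \<and> \<not> (f a < f d \<and> f d < f b \<and> f b \<le> c'))
      \<longleftrightarrow> (\<not> (a \<le> c \<and> c < b \<and> b < d) \<and> \<not> (a < d \<and> d < b \<and> b \<le> c))"
      using assms by (simp add: not_le[symmetric])
  qed
  finally show ?thesis .
qed

lemma avoids_2413_4213_map:
  assumes "\<And>a b. a \<in> set xs \<Longrightarrow> b \<in> set xs \<Longrightarrow> f a < f b \<longleftrightarrow> a < b"
  shows "avoids_2413_4213 (map f xs) \<longleftrightarrow> avoids_2413_4213 xs"
proof -
  have "avoids p2413 (map f xs) = avoids p2413 xs" "avoids p4213 (map f xs) = avoids p4213 xs"
    by (rule avoids_map; use assms in \<open>auto simp: p2413_def p4213_def\<close>)+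
  then show ?thesis by (simp add: avoids_2413_4213_def)
qed

lemma avoids_2413_4213_shift [simp]:
  "avoids_2413_4213 (map ((+) k) xs) \<longleftrightarrow> avoids_2413_4213 xs"
  by (simp add: avoids_2413_4213_map)

lemma card_cuts_shift [simp]: "card (cuts (map ((+) k) xs)) = card (cuts xs)"
proof -
  have "cut_ok (k + c) (map ((+) k) xs) \<longleftrightarrow> cut_ok c xs" for c
    by (rule cut_ok_map) auto
  then have "cuts (map ((+) k) xs) = (+) k ` cuts xs" by (auto simp: cuts_def)
  then show ?thesis by (simp add: card_image)
qed

lemma cut_ok_append:
  "cut_ok c (u @ v) \<longleftrightarrow> cut_ok c u \<and> cut_ok c v \<and>
      (\<forall>d a b. subseq [d, a] u \<longrightarrow> b \<in> set v \<longrightarrow>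
        \<not> (a \<le> c \<and> c < b \<and> b < d) \<and> \<not> (a < d \<and> d < b \<and> b \<le> c)) \<and>
      (\<forall>d a b. d \<in> set u \<longrightarrow> subseq [a, b] v \<longrightarrow>
        \<not> (a \<le> c \<and> c < b \<and> b < d) \<and> \<not> (a < d \<and> d < b \<and> b \<le> c))"
  unfolding cut_ok_def subseq_append_expand by blast

lemma cut_ok_singleton [simp]: "cut_ok c [m]"
  by (simp add: cut_ok_def)

lemma avoids_singleton [simp]: "avoids R [m]"
  by (simp add: avoids_def)

lemma cut_ok_less: "(\<And>z. z \<in> set xs \<Longrightarrow> c < z) \<Longrightarrow> cut_ok c xs"
  by (fastforce simp: cut_ok_def dest: subseq_mem)

lemma cut_ok_min_first:
  assumes "below [m] v"
  shows "cut_ok c (m # v) \<longleftrightarrow> cut_ok c v"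
proof -
  have "\<not> (a \<le> c \<and> c < b \<and> b < m) \<and> \<not> (a < m \<and> m < b \<and> b \<le> c)" if "subseq [a, b] v" for a b
    using that assms by (auto simp: below_def dest!: subseq_mem)
  then show ?thesis using cut_ok_append[of c "[m]" v] by auto
qed

lemma avoids_2413_4213_min_first:
  assumes "below [m] v"
  shows "avoids_2413_4213 (m # v) \<longleftrightarrow> avoids_2413_4213 v"
proof -
  have "\<not> p2413 m b c d \<and> \<not> p4213 m b c d" if "subseq [b, c, d] v" for b c d
    using subseq_mem(2)[OF that] assms by (auto simp: p2413_def p4213_def below_def)
  then show ?thesis
    using avoids_append[of p2413 "[m]" v] avoids_append[of p4213 "[m]" v]
    by (simp add: avoids_2413_4213_def)
qed

lemma avoids_2413_4213_min_last:
  assumes "below [m] u"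
  shows "avoids_2413_4213 (u @ [m]) \<longleftrightarrow> avoids_2413_4213 u"
proof -
  have "\<not> p2413 a b c m \<and> \<not> p4213 a b c m" if "subseq [a, b, c] u" for a b c
    using subseq_mem(2)[OF that] assms by (auto simp: p2413_def p4213_def below_def)
  then show ?thesis
    using avoids_append[of p2413 u "[m]"] avoids_append[of p4213 u "[m]"]
    by (simp add: avoids_2413_4213_def)
qed

lemma cuts_min_first:
  assumes "below [m] v"
  shows "cuts (m # v) = insert m (cuts v)"
proof -
  have lt: "m < z" if "z \<in> set v" for z using assms that by (auto simp: below_def)
  then have "cut_ok m v" by (rule cut_ok_less)
  then show ?thesis by (auto simp: cuts_def cut_ok_min_first[OF assms])
qed

lemma cuts_min_last:
  assumes "below [m] u"
  shows "cuts (u @ [m]) = insert m (cuts u)"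
proof -
  have lt: "m < z" if "z \<in> set u" for z using assms that by (auto simp: below_def)
  then have "cut_ok m u" by (rule cut_ok_less)
  moreover have "cut_ok c (u @ [m]) \<longleftrightarrow> cut_ok c u" if "c = m \<or> c \<in> set u" for c
    unfolding cut_ok_append using that by (auto dest!: subseq_mem lt)
  ultimately show ?thesis by (auto simp: cuts_def)
qed

text \<open>
  In \<open>u @ m # v\<close> with minimum \<open>m\<close>, no value of \<open>v\<close> separates the values of \<open>u\<close>, and \<open>c\<close> is the largest of
  the remaining values below them. So \<open>u @ m # v\<close> arises from \<open>a # m # v\<close> by replacing the entry \<open>a\<close> with
  the block \<open>u\<close>.
\<close>

definition inflated :: "nat list \<Rightarrow> nat \<Rightarrow> nat list \<Rightarrow> nat \<Rightarrow> bool" where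
  "inflated u m v c \<longleftrightarrow> u \<noteq> [] \<and> v \<noteq> [] \<and> c \<in> insert m (set v) \<and> below [m] (u @ v) \<and>
     (\<forall>a\<in>set u. c < a \<and> (\<forall>b\<in>set v. b \<le> c \<or> a < b))"

lemma inflatedD:
  assumes "inflated u m v c"
  shows "a \<in> set u \<Longrightarrow> m < a" "b \<in> set v \<Longrightarrow> m < b" "a \<in> set u \<Longrightarrow> c < a"
    "b \<in> set v \<Longrightarrow> a \<in> set u \<Longrightarrow> \<not> b \<le> c \<Longrightarrow> a < b"
    "b \<in> set v \<Longrightarrow> a \<in> set u \<Longrightarrow> a' \<in> set u \<Longrightarrow> a < b \<Longrightarrow> \<not> b < a'"
proof -
  have *: "\<forall>z\<in>set u \<union> set v. m < z" "\<forall>a\<in>set u. c < a \<and> (\<forall>b\<in>set v. b \<le> c \<or> a < b)"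
    using assms by (auto simp: inflated_def below_def)
  show "a \<in> set u \<Longrightarrow> m < a" "b \<in> set v \<Longrightarrow> m < b" "a \<in> set u \<Longrightarrow> c < a"
    "b \<in> set v \<Longrightarrow> a \<in> set u \<Longrightarrow> \<not> b \<le> c \<Longrightarrow> a < b" using * by blast+
  assume "b \<in> set v" "a \<in> set u" "a' \<in> set u" "a < b"
  then have "c < a" "b \<le> c \<or> a' < b" using *(2) by blast+
  then show "\<not> b < a'" using \<open>a < b\<close> by simp
qed

text \<open>
  An occurrence of 2413 or 4213 cannot have exactly two or three entries in \<open>u\<close>, because the value of its
  last letter lies between the values of its first two. So one that meets both \<open>u\<close> and \<open>m # v\<close> has only
  its first letter in \<open>u\<close>. It does not use \<open>m\<close>, since the minimum could only be the letter 1, which is the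
  third one, and the second letter would then lie in \<open>u\<close>. What is left is
  the condition that an entry in the place of \<open>u\<close> starts no pattern with three entries of \<open>v\<close>.
\<close>

lemma avoids_2413_4213_inflated:
  assumes "inflated u m v c"
  shows "avoids_2413_4213 (u @ m # v) \<longleftrightarrow>
    avoids_2413_4213 u \<and> avoids_2413_4213 v \<and> cut_ok c v"
proof -
  note D = inflatedD[OF assms]
  have split: "avoids R (u @ m # v) \<longleftrightarrow> avoids R u \<and> avoids R v \<and>
      (\<forall>a\<in>set u. \<forall>d b e. subseq [d, b, e] v \<longrightarrow> \<not> R a d b e)"
    if R: "R = p2413 \<or> R = p4213" for R
  proof -
    have "\<not> R m b c d" if "subseq [b, c, d] v" for b c d
      using subseq_mem(2)[OF that] D(2)[of c] R by (auto simp: p2413_def p4213_def)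
    then have mv: "avoids R (m # v) \<longleftrightarrow> avoids R v"
      using avoids_append[of R "[m]" v] by simp
    have "\<not> R a b e d" if "subseq [a, b, e] u" "d \<in> set (m # v)" for a b e d
    proof -
      have "a \<in> set u" "b \<in> set u" "d = m \<or> d \<in> set v"
        using that by (auto dest: subseq_mem)
      then show ?thesis
        using D(1)[of b] D(1)[of a] D(5)[of d a b] D(5)[of d b a] R
        by (auto simp: p2413_def p4213_def)
    qed
    moreover have "\<not> R a b e d" if "subseq [a, b] u" "subseq [e, d] (m # v)" for a b e d
    proof -
      have "d \<in> set v"
        using that(2) unfolding subseq_Cons_expand[of e "[d]" m v] subseq_singleton_left
        by (auto dest: subseq_mem)
      moreover have "a \<in> set u" "b \<in> set u" using subseq_mem(1)[OF that(1)] by simp_all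
      ultimately show ?thesis using D(5)[of d a b] D(5)[of d b a] R by (auto simp: p2413_def p4213_def)
    qed
    moreover have "\<not> R a m b e" if "a \<in> set u" "subseq [b, e] v" for a b e
      using subseq_mem(1)[OF that(2)] D(2)[of b] R by (auto simp: p2413_def p4213_def)
    ultimately show ?thesis
      unfolding avoids_append[of R u "m # v"] mv subseq_Cons_expand[of _ _ m v] by blast
  qed
  obtain a0 where a0: "a0 \<in> set u" using assms by (cases u) (auto simp: inflated_def)
  have "(\<forall>a\<in>set u. \<forall>d b e. subseq [d, b, e] v \<longrightarrow> \<not> p2413 a d b e \<and> \<not> p4213 a d b e) \<longleftrightarrow> cut_ok c v"
    (is "?L \<longleftrightarrow> _")
  proof
    assume L: ?L
    show "cut_ok c v" unfolding cut_ok_def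
    proof (intro allI impI)
      fix d b e assume s: "subseq [d, b, e] v"
      then have "d \<in> set v" "b \<in> set v" "e \<in> set v" by (auto dest!: subseq_mem)
      moreover have "\<not> p2413 a0 d b e \<and> \<not> p4213 a0 d b e" using L a0 s by blast
      ultimately show "\<not> (b \<le> c \<and> c < e \<and> e < d) \<and> \<not> (b < d \<and> d < e \<and> e \<le> c)"
        using D(3)[OF a0] D(4)[of e a0] a0 by (auto simp: p2413_def p4213_def)
    qed
  next
    assume C: "cut_ok c v"
    show ?L
    proof (intro ballI allI impI)
      fix a d b e assume a: "a \<in> set u" and s: "subseq [d, b, e] v"
      then have "d \<in> set v" "b \<in> set v" "e \<in> set v" by (auto dest!: subseq_mem)
      moreover have "\<not> (b \<le> c \<and> c < e \<and> e < d) \<and> \<not> (b < d \<and> d < e \<and> e \<le> c)"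
        using C s by (auto simp: cut_ok_def)
      ultimately show "\<not> p2413 a d b e \<and> \<not> p4213 a d b e"
        using D(3)[OF a] D(4)[of e a] D(4)[of b a] a by (auto simp: p2413_def p4213_def)
    qed
  qed
  then show ?thesis
    using split[of p2413] split[of p4213] unfolding avoids_2413_4213_def by blast
qed

text \<open>
  The place right below \<open>u\<close> is admissible, because the entries of \<open>u\<close> occupy a neighbouring place in
  front of \<open>v\<close>, and among the values of \<open>u\<close> only the patterns inside \<open>u\<close> matter. Any other cut \<open>k\<close> is
  blocked by an entry \<open>a\<close> of \<open>u\<close>: for \<open>k < c\<close> a new first entry forms 2413 with \<open>a, m, c\<close>, and for
  \<open>k\<close> above \<open>u\<close> it forms 4213 with \<open>a, m, k\<close>.
\<close>

lemma cuts_inflated: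
  assumes inf: "inflated u m v c" and av: "avoids_2413_4213 (u @ m # v)"
  shows "cuts (u @ m # v) = insert c (cuts u)"
proof -
  note D = inflatedD[OF inf]
  have okv: "cut_ok c v" using av avoids_2413_4213_inflated[OF inf] by blast
  obtain a0 where a0: "a0 \<in> set u" using inf by (cases u) (auto simp: inflated_def)
  have c: "c \<in> insert m (set v)" "m \<le> c"
    using inf D(2)[of c] by (auto simp: inflated_def)
  have tail: "cut_ok k (m # v) \<longleftrightarrow> cut_ok k v" for k
    by (rule cut_ok_min_first) (use D(2) in \<open>auto simp: below_def\<close>)
  have inside: "cut_ok k (u @ m # v) \<longleftrightarrow> cut_ok k u" if k: "k \<in> set u" for k
  proof -
    have "cut_ok k v" unfolding cut_ok_def
    proof (intro allI impI)
      fix d a b assume s: "subseq [d, a, b] v"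
      then have "a \<in> set v" "b \<in> set v" by (auto dest!: subseq_mem)
      then have "a \<le> c \<or> k < a" "b \<le> c \<or> k < b" using D(4) k by blast+
      moreover have "\<not> (a \<le> c \<and> c < b \<and> b < d) \<and> \<not> (a < d \<and> d < b \<and> b \<le> c)"
        using okv s unfolding cut_ok_def by blast
      ultimately show "\<not> (a \<le> k \<and> k < b \<and> b < d) \<and> \<not> (a < d \<and> d < b \<and> b \<le> k)"
        using D(3)[OF k] by linarith
    qed
    moreover have "\<not> (k < b \<and> b < d) \<and> \<not> (d < b \<and> b \<le> k)"
      if "d \<in> set u" "b \<in> set (m # v)" for d b
    proof (cases "b = m")
      case True
      then show ?thesis using D(1)[OF k] D(1)[OF that(1)] by auto
    next
      case False
      then have b: "b \<in> set v" using that by simp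
      have "b \<noteq> k" using D(3)[OF k] D(4)[OF b k] by force
      then show ?thesis
        using D(5)[OF b k that(1)] D(5)[OF b that(1) k] by force
    qed
    ultimately show ?thesis
      unfolding cut_ok_append tail
      using subseq_mem(1)[of _ _ u] subseq_mem(1)[of _ _ "m # v"] by blast
  qed
  have at_cut: "cut_ok c (u @ m # v)"
  proof -
    have "cut_ok c u" by (rule cut_ok_less) (rule D(3))
    moreover have "\<not> (c < b \<and> b < d)" "\<not> (d < b \<and> b \<le> c)"
      if "d \<in> set u" "b \<in> set (m # v)" for d b
      using that c D(3)[of d] D(4)[of b d] by auto
    ultimately show ?thesis
      unfolding cut_ok_append tail
      using okv subseq_mem(1)[of _ _ u] subseq_mem(1)[of _ _ "m # v"] by blast
  qed
  have outside: "k = c" if k: "k \<in> insert m (set v)" and ok: "cut_ok k (u @ m # v)" for k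
  proof (rule ccontr)
    assume "k \<noteq> c"
    have pat: "subseq [a0, m, b] (u @ m # v)" if "b \<in> set v" for b
      unfolding subseq_append_expand using a0 that
      by (simp add: subseq_singleton_left)
    show False
    proof (cases "k < c")
      case True
      have "m \<le> k" using k D(2)[of k] by auto
      then have "c \<in> set v" using c(1) True by auto
      then show False
        using ok pat[of c] True D(3)[OF a0] \<open>m \<le> k\<close> unfolding cut_ok_def by blast
    next
      case False
      then have "c < k" using \<open>k \<noteq> c\<close> by simp
      then have kv: "k \<in> set v" using k c by auto
      then have "a0 < k" using D(4)[of k a0] a0 \<open>c < k\<close> by simp
      then show False
        using ok pat[OF kv] D(1)[OF a0] order_refl[of k] unfolding cut_ok_def by blast
    qed
  qed
  show ?thesis
  proof (intro equalityI subsetI)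
    fix k assume "k \<in> cuts (u @ m # v)"
    then have ok: "cut_ok k (u @ m # v)" and "k \<in> set u \<or> k \<in> insert m (set v)"
      by (auto simp: cuts_def)
    then show "k \<in> insert c (cuts u)"
      using inside[of k] outside[of k] unfolding cuts_def by blast
  next
    fix k assume "k \<in> insert c (cuts u)"
    then consider "k = c" | "k \<in> set u" "cut_ok k u" by (auto simp: cuts_def)
    then show "k \<in> cuts (u @ m # v)"
    proof cases
      case 1
      then show ?thesis using at_cut c(1) by (auto simp: cuts_def)
    next
      case 2
      then show ?thesis using inside[of k]
        by (simp add: cuts_def)
    qed
  qed
qed

definition min_inside :: "nat list \<Rightarrow> bool" where
  "min_inside xs \<longleftrightarrow> (\<exists>u m v. xs = u @ m # v \<and> u \<noteq> [] \<and> v \<noteq> [] \<and> below [m] (u @ v))"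

text \<open>
  The map that makes room in \<open>{1..n}\<close> for a minimum \<open>1\<close> and for \<open>i\<close> consecutive values
  directly above the image of \<open>c\<close>.
\<close>

definition lift_above :: "nat \<Rightarrow> nat \<Rightarrow> nat \<Rightarrow> nat" where
  "lift_above i c x = (if x \<le> c then Suc x else Suc (x + i))"

definition unlift_above :: "nat \<Rightarrow> nat \<Rightarrow> nat \<Rightarrow> nat" where
  "unlift_above i c x = (if x \<le> Suc c then x - 1 else x - Suc i)"

lemma lift_above_strict_mono: "strict_mono (lift_above i c)"
  by (auto simp: strict_mono_def lift_above_def)

lemma lift_above_less_iff [simp]: "lift_above i c x < lift_above i c y \<longleftrightarrow> x < y"
  by (rule strict_mono_less[OF lift_above_strict_mono])

lemma unlift_lift [simp]: "unlift_above i c (lift_above i c x) = x"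
  by (auto simp: lift_above_def unlift_above_def)

lemma lift_above_image:
  assumes "c \<le> k"
  shows "lift_above i c ` {1..k} = {2..Suc (k + i)} - {c + 2..Suc (c + i)}"
proof (intro equalityI subsetI)
  fix y assume y: "y \<in> {2..Suc (k + i)} - {c + 2..Suc (c + i)}"
  have "lift_above i c (unlift_above i c y) = y" "unlift_above i c y \<in> {1..k}"
    using y assms by (auto simp: lift_above_def unlift_above_def)
  then show "y \<in> lift_above i c ` {1..k}" by (metis imageI)
qed (use assms in \<open>auto simp: lift_above_def\<close>)

text \<open>
  Otherwise \<open>a\<close>, \<open>b\<close> and \<open>m\<close>, \<open>z\<close> form 2413 or 4213, depending on the order of \<open>a\<close> and \<open>b\<close>.
\<close>

lemma avoids_2413_4213_interval:
  assumes av: "avoids_2413_4213 (u @ m # v)" and mu: "below [m] (u @ v)" and dist: "distinct (u @ m # v)"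
    and "a \<in> set u" "b \<in> set u" "a < z" "z < b"
  shows "z \<notin> set v"
proof
  assume z: "z \<in> set v"
  have "m < a" using mu \<open>a \<in> set u\<close> by (auto simp: below_def)
  have pat: "subseq [p, q, m, z] (u @ m # v)" if "subseq [p, q] u" for p q
    unfolding subseq_append_expand using that z by (simp add: subseq_singleton_left)
  obtain u1 u2 where u: "u = u1 @ a # u2" using \<open>a \<in> set u\<close> by (meson split_list)
  have "b \<in> set u1 \<or> b \<in> set u2" using \<open>b \<in> set u\<close> assms(6,7) u by auto
  then have "subseq [b, a] u \<or> subseq [a, b] u"
    unfolding u subseq_append_expand by (auto simp: subseq_singleton_left)
  then show False
  proof
    assume "subseq [b, a] u"
    then show False using av pat[of b a] \<open>m < a\<close> assms(6,7)
      by (auto simp: avoids_2413_4213_def avoids_def p4213_def)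
  next
    assume "subseq [a, b] u"
    then show False using av pat[of a b] \<open>m < a\<close> assms(6,7)
      by (auto simp: avoids_2413_4213_def avoids_def p2413_def)
  qed
qed

text \<open>
  A list \<open>u @ m # v\<close> of this kind is encoded by the standardisations of \<open>u\<close> and \<open>v\<close> and by the cut \<open>c\<close> of \<open>v\<close> at
  which the values of \<open>u\<close> are inserted; \<open>c = 0\<close> stands for the cut below all entries. Hence each \<open>v\<close> is counted
  \<open>Suc (card (cuts v))\<close> times.
\<close>

lemma gf_min_inside:
  fixes g w f :: "nat list \<Rightarrow> 'a::comm_ring_1"
  assumes f: "\<And>u m v c. distinct (u @ m # v) \<Longrightarrow> inflated u m v c \<Longrightarrow>
      avoids_2413_4213 (u @ m # v) \<Longrightarrow> f (u @ m # v) = t * g u * w v"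
    and g: "\<And>k u. g (map ((+) k) u) = g u"
    and w: "\<And>h v. strict_mono h \<Longrightarrow> w (map h v) = w v"
  shows "gf (\<lambda>xs. avoids_2413_4213 xs \<and> min_inside xs) f
    = fps_const t * fps_X * gf (\<lambda>xs. avoids_2413_4213 xs \<and> xs \<noteq> []) g
      * gf (\<lambda>xs. avoids_2413_4213 xs \<and> xs \<noteq> []) (\<lambda>v. of_nat (Suc (card (cuts v))) * w v)"
    (is "?L = _ * _ * gf ?B g * gf ?B ?h")
proof (rule fps_ext)
  fix N
  show "fps_nth ?L N = fps_nth (fps_const t * fps_X * gf ?B g * gf ?B ?h) N"
  proof (cases N)
    case 0
    have "\<not> min_inside []" by (simp add: min_inside_def)
    then show ?thesis using 0
      by (auto simp: gf_nth mult.assoc intro!: sum.neutral)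
  next
    case (Suc n)
    let ?A = "{xs. xs \<in> permutations_of_set {1..Suc n} \<and> avoids_2413_4213 xs \<and> min_inside xs}"
    let ?P = "\<lambda>i. {u. u \<in> permutations_of_set {1..i} \<and> ?B u}"
    let ?S = "SIGMA i:{0..n}. ?P i \<times> (SIGMA v:?P (n - i). insert 0 (cuts v))"
    let ?c = "\<lambda>(i, u, v, c). map ((+) (Suc c)) u @ 1 # map (lift_above i c) v"
    have S: "i = length u \<and> i \<le> n \<and> 0 < i \<and> c \<le> n - i \<and>
        set (map ((+) (Suc c)) u) = {c + 2..Suc (c + i)} \<and>
        set (map (lift_above i c) v) = {2..Suc n} - {c + 2..Suc (c + i)} \<and>
        1 \<notin> set (map ((+) (Suc c)) u) \<and> 1 \<notin> set (map (lift_above i c) v) \<and>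
        ?c (i, u, v, c) \<in> ?A \<and> distinct (?c (i, u, v, c)) \<and>
        inflated (map ((+) (Suc c)) u) 1 (map (lift_above i c) v) (Suc c)"
      if "(i, u, v, c) \<in> ?S" for i u v c
    proof -
      let ?u = "map ((+) (Suc c)) u" and ?v = "map (lift_above i c) v"
      have u: "set u = {1..i}" "distinct u" "avoids_2413_4213 u" "u \<noteq> []"
        and v: "set v = {1..n - i}" "distinct v" "avoids_2413_4213 v" "v \<noteq> []"
        and i: "i \<le> n" and c: "c = 0 \<or> c \<in> cuts v"
        using that by (auto simp: permutations_of_set_def)
      have len: "i = length u" using distinct_card[OF u(2)] u(1) by simp
      have i0: "0 < i" using len u(4) by simp
      have cle: "c \<le> n - i" using c v(1) by (auto simp: cuts_def)
      have su: "set ?u = {c + 2..Suc (c + i)}"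
        unfolding set_map u(1) image_add_atLeastAtMost by simp
      have sv: "set ?v = {2..Suc n} - {c + 2..Suc (c + i)}"
        using lift_above_image[OF cle, of i] i v(1) by simp
      have "cut_ok c v" using c v(1) by (auto simp: cuts_def intro: cut_ok_less)
      moreover have "cut_ok (Suc c) ?v \<longleftrightarrow> cut_ok c v"
        by (rule cut_ok_map) (auto simp: lift_above_def)
      ultimately have ok: "cut_ok (Suc c) ?v" by simp
      have inf: "inflated ?u 1 ?v (Suc c)"
      proof -
        have "Suc c \<in> insert 1 (set ?v)" unfolding sv using cle i i0 by auto
        moreover have "below [1] (?u @ ?v)"
          unfolding below_def set_append su sv by auto
        moreover have "\<forall>a\<in>set ?u. Suc c < a \<and> (\<forall>b\<in>set ?v. b \<le> Suc c \<or> a < b)"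
          unfolding su sv by auto
        ultimately show ?thesis using u(4) v(4) by (simp add: inflated_def)
      qed
      have "avoids_2413_4213 ?v" using v(3) by (simp add: avoids_2413_4213_map)
      then have av: "avoids_2413_4213 (?u @ 1 # ?v)"
        unfolding avoids_2413_4213_inflated[OF inf] using ok u(3) by simp
      have "distinct ?u" "distinct ?v"
        using u(2) v(2) strict_mono_imp_inj_on[OF lift_above_strict_mono]
        by (simp_all add: distinct_map inj_on_subset)
      then have dist: "distinct (?u @ 1 # ?v)" using su sv by auto
      have "set (?u @ 1 # ?v) = {1..Suc n}"
        unfolding set_append list.set(2) su sv using cle i by auto
      then have "?c (i, u, v, c) \<in> ?A"
        using av dist inf by (auto simp: permutations_of_set_def min_inside_def inflated_def simp del: set_map)
      moreover have "1 \<notin> set ?u \<and> 1 \<notin> set ?v" using dist by (simp only: distinct_append) auto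
      ultimately show ?thesis using len i i0 cle su sv dist inf by (simp del: set_map)
    qed
    have inj: "inj_on ?c ?S"
    proof (rule inj_onI)
      fix p q assume pq: "p \<in> ?S" "q \<in> ?S" "?c p = ?c q"
      obtain i u v c where p: "p = (i, u, v, c)" by (cases p)
      obtain i' u' v' c' where q: "q = (i', u', v', c')" by (cases q)
      note Sp = S[OF pq(1)[unfolded p]] and Sq = S[OF pq(2)[unfolded q]]
      have "1 \<notin> set (map ((+) (Suc c)) u)" "1 \<notin> set (map ((+) (Suc c')) u')"
        using Sp Sq by blast+
      moreover have "map ((+) (Suc c)) u @ 1 # map (lift_above i c) v
        = map ((+) (Suc c')) u' @ 1 # map (lift_above i' c') v'"
        using pq(3) by (simp add: p q)
      moreover have "1 \<notin> set (map (lift_above i c) v)" using Sp by blast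
      ultimately have eq: "map ((+) (Suc c)) u = map ((+) (Suc c')) u'"
        "map (lift_above i c) v = map (lift_above i' c') v'"
        using append_Cons_eq_iff[of 1 "map ((+) (Suc c)) u" "map (lift_above i c) v"] by blast+
      have ii: "i = i'" using eq(1) Sp Sq by (metis length_map)
      have "{c + 2..Suc (c + i)} = {c' + 2..Suc (c' + i)}" using eq(1) Sp Sq ii by metis
      then have cc: "c = c'" using Sp by (simp add: Icc_eq_Icc)
      have "u = u'" using eq(1) unfolding cc by (simp add: inj_map_eq_map)
      moreover have "v = v'" using eq(2) unfolding cc ii
        by (metis inj_map_eq_map lift_above_strict_mono strict_mono_imp_inj_on)
      ultimately show "p = q" by (simp add: p q ii cc)
    qed
    have img: "?c ` ?S = ?A"
    proof (intro equalityI subsetI)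
      fix xs assume "xs \<in> ?c ` ?S"
      then obtain p where p: "p \<in> ?S" "xs = ?c p" by blast
      obtain i u v c where "p = (i, u, v, c)" by (cases p)
      then show "xs \<in> ?A" using S[of i u v c] p by blast
    next
      fix xs assume xs: "xs \<in> ?A"
      then obtain u m v where eq: "xs = u @ m # v" and ne: "u \<noteq> []" "v \<noteq> []"
        and m: "below [m] (u @ v)"
        by (auto simp: min_inside_def)
      have dist: "distinct (u @ m # v)" and set: "set (u @ m # v) = {1..Suc n}"
        and av: "avoids_2413_4213 (u @ m # v)"
        using xs eq by (auto simp: permutations_of_set_def)
      have m1: "m = 1"
      proof -
        have "1 \<in> set (u @ m # v)" "m \<in> {1..Suc n}" using set by auto
        then show ?thesis using m by (auto simp: below_def)
      qed
      define a where "a = Min (set u)"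
      define b where "b = Max (set u)"
      have ab: "a \<in> set u" "b \<in> set u" "\<And>z. z \<in> set u \<Longrightarrow> a \<le> z \<and> z \<le> b"
        using ne by (auto simp: a_def b_def)
      have "1 < a" "b \<le> Suc n" using ab m set unfolding m1 by (auto simp: below_def)
      have su: "set u = {a..b}"
      proof (intro equalityI subsetI)
        fix z assume z: "z \<in> {a..b}"
        then have "z \<in> set (u @ m # v)" unfolding set using \<open>1 < a\<close> \<open>b \<le> Suc n\<close> by auto
        moreover have "z \<notin> set v"
        proof
          assume "z \<in> set v"
          moreover from this have "z \<noteq> a" "z \<noteq> b" using ab dist by auto
          ultimately show False
            using avoids_2413_4213_interval[OF av m dist ab(1,2), of z] z by auto
        qed
        ultimately show "z \<in> set u" using z \<open>1 < a\<close> m1 by auto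
      qed (use ab in auto)
      \<comment> \<open>The values below those of \<open>u\<close> are \<open>1\<close> and the \<open>a - 2\<close> smallest values of \<open>v\<close>.\<close>
      define c where "c = a - 2"
      define i where "i = length u"
      have ai: "a = c + 2" "b = Suc (c + i)"
      proof -
        show "a = c + 2" using \<open>1 < a\<close> by (simp add: c_def)
        moreover have "i = Suc b - a" using distinct_card[of u] dist su by (simp add: i_def)
        moreover have "a \<le> b" using ab by blast
        ultimately show "b = Suc (c + i)" by simp
      qed
      have "0 < i" using ne by (simp add: i_def)
      have i: "i \<le> n" "c \<le> n - i" using ai \<open>b \<le> Suc n\<close> by auto
      have sv: "set v = {2..Suc n} - {c + 2..Suc (c + i)}"
      proof -
        have "set v = {1..Suc n} - {1} - set u"
          unfolding set[symmetric] using dist m1 by auto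
        moreover have "{1..Suc n} - {1} = {2..Suc n}" by auto
        ultimately show ?thesis by (simp only: su ai)
      qed
      define u' where "u' = map (\<lambda>x. x - Suc c) u"
      define v' where "v' = map (unlift_above i c) v"
      have u': "u = map ((+) (Suc c)) u'"
        unfolding u'_def map_map using su ai by (intro map_idI[symmetric]) auto
      have lv: "lift_above i c ` {1..n - i} = set v"
        using lift_above_image[OF i(2), of i] i(1) sv by simp
      have v': "v = map (lift_above i c) v'"
        unfolding v'_def map_map using lv by (intro map_idI[symmetric]) (auto simp flip: lv)
      have su': "set u' = {1..i}"
      proof -
        have "set u = (+) (Suc c) ` {1..i}" unfolding su ai image_add_atLeastAtMost by simp
        then show ?thesis unfolding u'_def by (simp add: image_image)
      qed
      have sv': "set v' = {1..n - i}"
        unfolding v'_def by (simp add: image_image flip: lv)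
      have du: "distinct u'" "distinct v'" using dist u' v' by (simp_all add: distinct_map)
      have inf: "inflated u m v (Suc c)"
      proof -
        have "Suc c \<in> insert m (set v)" unfolding sv m1 using i \<open>0 < i\<close> by auto
        moreover have "\<forall>a\<in>set u. Suc c < a \<and> (\<forall>b\<in>set v. b \<le> Suc c \<or> a < b)"
          unfolding su sv ai by auto
        ultimately show ?thesis using ne m by (simp add: inflated_def)
      qed
      have avs: "avoids_2413_4213 u" "avoids_2413_4213 v" "cut_ok (Suc c) v"
        using av avoids_2413_4213_inflated[OF inf] by blast+
      have "cut_ok (Suc c) (map (lift_above i c) v') \<longleftrightarrow> cut_ok c v'"
        by (rule cut_ok_map) (auto simp: lift_above_def)
      then have "c \<in> insert 0 (cuts v')"
        using avs(3) i(2) unfolding cuts_def sv' v'[symmetric] by auto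
      moreover have "avoids_2413_4213 u'" "avoids_2413_4213 v'"
        using avs(1,2) u' v' avoids_2413_4213_shift[of "Suc c" u']
          avoids_2413_4213_map[of v' "lift_above i c"] by auto
      ultimately have "(i, u', v', c) \<in> ?S"
        using i su' sv' du ne by (auto simp: permutations_of_set_def u'_def v'_def)
      moreover have "xs = ?c (i, u', v', c)" using eq u' v' m1 by simp
      ultimately show "xs \<in> ?c ` ?S" by blast
    qed
    have "fps_nth ?L N = sum f (?c ` ?S)" by (simp only: gf_nth img Suc)
    also have "\<dots> = (\<Sum>p\<in>?S. f (?c p))" by (rule sum.reindex[OF inj, unfolded comp_def])
    also have "\<dots> = (\<Sum>(i, u, vc)\<in>?S. t * g u * w (fst vc))"
    proof (rule sum.cong[OF refl])
      fix p assume p: "p \<in> ?S"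
      obtain i u v c where iuvc: "p = (i, u, v, c)" by (cases p)
      note Sp = S[OF p[unfolded iuvc]]
      have "f (?c (i, u, v, c)) = t * g (map ((+) (Suc c)) u) * w (map (lift_above i c) v)"
        unfolding prod.case using Sp by (intro f) auto
      then show "f (?c p) = (case p of (i, u, vc) \<Rightarrow> t * g u * w (fst vc))"
        unfolding iuvc by (simp add: g w lift_above_strict_mono)
    qed
    also have "\<dots> = (\<Sum>i=0..n. \<Sum>(u, vc)\<in>?P i \<times> (SIGMA v:?P (n - i). insert 0 (cuts v)). t * g u * w (fst vc))"
      by (rule sum.Sigma[symmetric]) auto
    also have "\<dots> = (\<Sum>i=0..n. \<Sum>u\<in>?P i. \<Sum>vc\<in>(SIGMA v:?P (n - i). insert 0 (cuts v)). t * g u * w (fst vc))"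
      by (intro sum.cong refl sum.cartesian_product[symmetric])
    also have "\<dots> = (\<Sum>i=0..n. \<Sum>u\<in>?P i. \<Sum>v\<in>?P (n - i). \<Sum>c\<in>insert 0 (cuts v). t * g u * w v)"
      by (intro sum.cong refl, subst sum.Sigma) (auto simp: case_prod_beta)
    also have "\<dots> = (\<Sum>i=0..n. \<Sum>u\<in>?P i. \<Sum>v\<in>?P (n - i). t * g u * ?h v)"
    proof (intro sum.cong refl)
      fix i u v assume "v \<in> ?P (n - i)"
      then have "0 \<notin> cuts v" by (auto simp: cuts_def permutations_of_set_def)
      then have "card (insert 0 (cuts v)) = Suc (card (cuts v))" by simp
      then show "(\<Sum>c\<in>insert 0 (cuts v). t * g u * w v) = t * g u * ?h v"
        by (simp only: sum_constant) (simp only: ac_simps)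
    qed
    also have "\<dots> = (\<Sum>i=0..n. t * (sum g (?P i) * sum ?h (?P (n - i))))"
      by (intro sum.cong refl) (simp only: mult.assoc flip: sum_distrib_left sum_distrib_right)
    also have "\<dots> = t * fps_nth (gf ?B g * gf ?B ?h) n"
      by (simp only: fps_mult_nth gf_nth sum_distrib_left)
    also have "\<dots> = fps_nth (fps_const t * fps_X * gf ?B g * gf ?B ?h) N"
      by (simp add: Suc mult.assoc)
    finally show ?thesis .
  qed
qed

lemma wt_map:
  assumes "strict_mono f"
  shows "wt t x y l r (map f xs) = wt t x y l r xs"
  by (simp add: wt_def descents_map double_descents_map initial_run_map strict_mono_less[OF assms])

context
  fixes t x :: "'a::comm_ring_1"
begin

lemma gf_2413_4213_min_first:
  assumes f: "\<And>a v. below [a] v \<Longrightarrow> v \<noteq> [] \<Longrightarrow> distinct (a # v) \<Longrightarrow> f (a # v) = p * g v"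
    and g: "\<And>k u. g (map ((+) k) u) = (g u :: 'a)"
  shows "gf (\<lambda>xs. avoids_2413_4213 xs \<and> (\<exists>a v. xs = a # v \<and> v \<noteq> [] \<and> below [a] v)) f
    = fps_const p * fps_X * gf (\<lambda>xs. avoids_2413_4213 xs \<and> xs \<noteq> []) g"
proof -
  have "gf (\<lambda>xs. avoids_2413_4213 xs \<and> (\<exists>a v. xs = a # v \<and> v \<noteq> [] \<and> below [a] v)) f
    = gf singleton (\<lambda>_. p) * gf (\<lambda>xs. avoids_2413_4213 xs \<and> xs \<noteq> []) g"
  proof (rule gf_direct_sum)
    fix xs assume "avoids_2413_4213 xs \<and> (\<exists>a v. xs = a # v \<and> v \<noteq> [] \<and> below [a] v)"
    then obtain a v where "xs = [a] @ v" "v \<noteq> []" "below [a] v" "avoids_2413_4213 v"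
      using avoids_2413_4213_min_first by auto
    then show "\<exists>u v. xs = u @ v \<and> below u v \<and> singleton u \<and> avoids_2413_4213 v \<and> v \<noteq> []"
      unfolding singleton_def by blast
  next
    fix u v assume "distinct (u @ v)" and uv: "below u v" "singleton u" "avoids_2413_4213 v \<and> v \<noteq> []"
    then obtain a where "u = [a]" by (auto simp: singleton_def)
    then show "(avoids_2413_4213 (u @ v) \<and> (\<exists>a w. u @ v = a # w \<and> w \<noteq> [] \<and> below [a] w)) \<and>
        f (u @ v) = p * g v"
      using uv f[of a v] \<open>distinct (u @ v)\<close> avoids_2413_4213_min_first[of a v] by simp
  qed (auto simp: singleton_def g)
  then show ?thesis by (simp add: gf_singleton)
qed

lemma gf_2413_4213_min_last:
  assumes f: "\<And>m u. below [m] u \<Longrightarrow> u \<noteq> [] \<Longrightarrow> distinct (u @ [m]) \<Longrightarrow> f (u @ [m]) = q * g u"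
    and g: "\<And>k u. g (map ((+) k) u) = (g u :: 'a)"
  shows "gf (\<lambda>xs. avoids_2413_4213 xs \<and> (\<exists>u m. xs = u @ [m] \<and> u \<noteq> [] \<and> below [m] u)) f
    = fps_const q * fps_X * gf (\<lambda>xs. avoids_2413_4213 xs \<and> xs \<noteq> []) g"
proof -
  have "gf (\<lambda>xs. avoids_2413_4213 xs \<and> (\<exists>u m. xs = u @ [m] \<and> u \<noteq> [] \<and> below [m] u)) f
    = gf (\<lambda>xs. avoids_2413_4213 xs \<and> xs \<noteq> []) g * gf singleton (\<lambda>_. q)"
  proof (rule gf_skew_sum)
    fix xs assume "avoids_2413_4213 xs \<and> (\<exists>u m. xs = u @ [m] \<and> u \<noteq> [] \<and> below [m] u)"
    then obtain u m where "xs = u @ [m]" "u \<noteq> []" "below [m] u" "avoids_2413_4213 u"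
      using avoids_2413_4213_min_last by auto
    then show "\<exists>u v. xs = u @ v \<and> below v u \<and> (avoids_2413_4213 u \<and> u \<noteq> []) \<and> singleton v"
      unfolding singleton_def by blast
  next
    fix u v assume "distinct (u @ v)" and uv: "below v u" "avoids_2413_4213 u \<and> u \<noteq> []" "singleton v"
    then obtain m where "v = [m]" by (auto simp: singleton_def)
    then show "(avoids_2413_4213 (u @ v) \<and> (\<exists>w m. u @ v = w @ [m] \<and> w \<noteq> [] \<and> below [m] w)) \<and>
        f (u @ v) = g u * q"
      using uv f[of m u] \<open>distinct (u @ v)\<close> avoids_2413_4213_min_last[of m u]
      by (simp add: mult.commute)
  qed (auto simp: singleton_def g)
  then show ?thesis by (simp add: gf_singleton mult_ac)
qed

text \<open>
  The weight \<open>f\<close> is kept general since the decomposition is needed twice, for the weights \<open>wt\<close> and for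
  these weights multiplied by the number of admissible cuts.
\<close>

lemma gf_2413_4213_by_position_of_min:
  assumes first: "\<And>a v. below [a] v \<Longrightarrow> v \<noteq> [] \<Longrightarrow> distinct (a # v) \<Longrightarrow> f (a # v) = p * g v"
    and last: "\<And>m u. below [m] u \<Longrightarrow> u \<noteq> [] \<Longrightarrow> distinct (u @ [m]) \<Longrightarrow> f (u @ [m]) = q * g u"
    and inside: "\<And>u m v c. distinct (u @ m # v) \<Longrightarrow> inflated u m v c \<Longrightarrow>
      avoids_2413_4213 (u @ m # v) \<Longrightarrow> f (u @ m # v) = t * g u * wt t x 1 False True v"
    and g: "\<And>k u. g (map ((+) k) u) = (g u :: 'a)"
  shows "gf (\<lambda>xs. avoids_2413_4213 xs \<and> xs \<noteq> []) f
    = fps_const (f [1]) * fps_X + (fps_const p * fps_X + fps_const q * fps_X + fps_const t * fps_X *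
        gf (\<lambda>xs. avoids_2413_4213 xs \<and> xs \<noteq> [])
          (\<lambda>v. of_nat (Suc (card (cuts v))) * wt t x 1 False True v))
      * gf (\<lambda>xs. avoids_2413_4213 xs \<and> xs \<noteq> []) g"
proof -
  let ?E1 = "\<lambda>xs. avoids_2413_4213 xs \<and> (\<exists>a v. xs = a # v \<and> v \<noteq> [] \<and> below [a] v)"
  let ?E2 = "\<lambda>xs. avoids_2413_4213 xs \<and> (\<exists>u m. xs = u @ [m] \<and> u \<noteq> [] \<and> below [m] u)"
  let ?E3 = "\<lambda>xs. avoids_2413_4213 xs \<and> min_inside xs"
  have position: "singleton xs \<or> (\<exists>a v. xs = a # v \<and> v \<noteq> [] \<and> below [a] v) \<or>
      (\<exists>u m. xs = u @ [m] \<and> u \<noteq> [] \<and> below [m] u) \<or> min_inside xs"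
    if "distinct xs" "xs \<noteq> []" for xs
  proof -
    obtain u v where uv: "xs = u @ Min (set xs) # v"
      using \<open>xs \<noteq> []\<close> by (metis List.finite_set Min_in set_empty split_list)
    have "below [Min (set xs)] (u @ v)"
    proof -
      have "Min (set xs) < b" if "b \<in> set (u @ v)" for b
      proof -
        have "b \<in> set xs" using that uv by (metis Un_iff list.set_intros(2) set_append)
        moreover have "b \<noteq> Min (set xs)" using that uv \<open>distinct xs\<close> by (metis distinct_append not_distinct_conv_prefix Un_iff disjoint_iff distinct.simps(2) list.set_intros(1) set_append)
        ultimately show ?thesis by (metis List.finite_set Min_le le_neq_implies_less)
      qed
      then show ?thesis by (auto simp: below_def)
    qed
    with uv obtain m where m: "xs = u @ m # v" "below [m] (u @ v)" by blast
    consider "u = []" "v = []" | "u = []" "v \<noteq> []" | "u \<noteq> []" "v = []" | "u \<noteq> []" "v \<noteq> []" by blast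
    then show ?thesis
    proof cases
      case 4
      then show ?thesis using m unfolding min_inside_def by blast
    qed (use m in \<open>auto simp: singleton_def\<close>)
  qed
  have "gf (\<lambda>xs. avoids_2413_4213 xs \<and> xs \<noteq> []) f
    = gf singleton f + gf (\<lambda>xs. ?E1 xs \<or> ?E2 xs \<or> ?E3 xs) f"
  proof (rule gf_disjoint_union)
    fix xs :: "nat list" assume "distinct xs"
    have "singleton xs \<Longrightarrow> avoids_2413_4213 xs \<and> xs \<noteq> []"
      by (auto simp: singleton_def avoids_2413_4213_def)
    then show "(avoids_2413_4213 xs \<and> xs \<noteq> []) \<longleftrightarrow> singleton xs \<or> ?E1 xs \<or> ?E2 xs \<or> ?E3 xs"
      using position[OF \<open>distinct xs\<close>] by (auto simp: min_inside_def)
  next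
    fix xs assume "singleton xs"
    then show "\<not> (?E1 xs \<or> ?E2 xs \<or> ?E3 xs)"
      by (auto simp: singleton_def min_inside_def append_eq_Cons_conv Cons_eq_append_conv)
  qed
  also have "gf (\<lambda>xs. ?E1 xs \<or> ?E2 xs \<or> ?E3 xs) f = gf ?E1 f + gf (\<lambda>xs. ?E2 xs \<or> ?E3 xs) f"
  proof (rule gf_disjoint_union)
    fix xs assume "?E1 xs"
    then obtain a v where xs: "xs = a # v" "below [a] v" by blast
    have "\<not> below [m] u" if "xs = u @ m # w" "u \<noteq> []" for u m w
      using that xs by (cases u) (auto simp: below_def)
    then show "\<not> (?E2 xs \<or> ?E3 xs)" unfolding min_inside_def below_append by blast
  qed simp
  also have "gf (\<lambda>xs. ?E2 xs \<or> ?E3 xs) f = gf ?E2 f + gf ?E3 f"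
  proof (rule gf_disjoint_union)
    fix xs assume "?E2 xs"
    then obtain u m where xs: "xs = u @ [m]" "below [m] u" by blast
    have "\<not> below [k] w" if vw: "xs = v @ k # w" "w \<noteq> []" for v k w
    proof -
      obtain w' z where w: "w = w' @ [z]" using vw(2) by (cases w rule: rev_cases) auto
      then have "u @ [m] = (v @ k # w') @ [z]" using vw(1) xs(1) by simp
      then have "z = m" "u = v @ k # w'" by (simp_all only: append1_eq_conv)
      then show ?thesis using xs(2) w by (auto simp: below_def)
    qed
    then show "\<not> ?E3 xs" unfolding min_inside_def below_append by blast
  qed simp
  also have "gf singleton f = fps_const (f [1]) * fps_X" by (rule gf_singleton)
  also have "gf ?E1 f = fps_const p * fps_X * gf (\<lambda>xs. avoids_2413_4213 xs \<and> xs \<noteq> []) g"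
    by (rule gf_2413_4213_min_first) (use first g in auto)
  also have "gf ?E2 f = fps_const q * fps_X * gf (\<lambda>xs. avoids_2413_4213 xs \<and> xs \<noteq> []) g"
    by (rule gf_2413_4213_min_last) (use last g in auto)
  also have "gf ?E3 f = fps_const t * fps_X * gf (\<lambda>xs. avoids_2413_4213 xs \<and> xs \<noteq> []) g
      * gf (\<lambda>xs. avoids_2413_4213 xs \<and> xs \<noteq> [])
          (\<lambda>v. of_nat (Suc (card (cuts v))) * wt t x 1 False True v)"
    by (rule gf_min_inside) (use inside g wt_map in auto)
  finally show ?thesis by (simp add: algebra_simps)
qed

lemma wt_min_last:
  assumes "below [m] u" "u \<noteq> []"
  shows "wt t x y False True (u @ [m]) = t * x * wt t x y False True u"
  using assms wt_descent[of u "[m]" t x y False True]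
  by (simp add: wt_singleton below_def mult_ac)

lemma wt_inflated:
  assumes "inflated u m v c"
  shows "wt t x y False True (u @ m # v) = t * wt t x y False True u * wt t x 1 False True v"
proof -
  have uv: "u \<noteq> []" "v \<noteq> []" and m: "m < last u" "m < hd v"
    using assms by (auto simp: inflated_def below_def)
  have "wt t x 1 True True (m # v) = wt t x 1 False True v"
    using uv(2) m(2) by (cases v) (simp_all add: wt_def)
  then show ?thesis using wt_descent[of u "m # v" t x y False True] uv m by simp
qed

text \<open>
  The number of admissible cuts is one for a singleton, and otherwise one more than for the part
  that the recursion keeps. Hence \<open>H = fps_X + Q 1 * (S + H)\<close>, where \<open>S + H\<close> counts the kept parts with this
  increased weight; by the equation for \<open>S\<close> the terms without \<open>H\<close> sum up to \<open>S\<close>.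
\<close>

theorem gf_2413_4213_equations:
  fixes y :: 'a
  defines "B \<equiv> \<lambda>xs. avoids_2413_4213 xs \<and> xs \<noteq> []"
  defines "N \<equiv> gf B (wt t x y False True)"
    and "S \<equiv> gf B (wt t x 1 False True)"
    and "H \<equiv> gf B (\<lambda>xs. of_nat (card (cuts xs)) * wt t x 1 False True xs)"
  defines "Q \<equiv> \<lambda>y. fps_const y * fps_X + fps_const (t * x) * fps_X + fps_const t * fps_X * (S + H)"
  shows "N = fps_const y * fps_X + Q y * N"
    and "H = S + Q 1 * H"
proof -
  have C: "gf B (\<lambda>v. of_nat (Suc (card (cuts v))) * wt t x 1 False True v) = S + H"
    unfolding S_def H_def gf_add[symmetric] by (simp add: algebra_simps)
  have N: "gf B (wt t x z False True)
      = fps_const z * fps_X + Q z * gf B (wt t x z False True)" for z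
    unfolding Q_def C[symmetric] unfolding B_def
    by (subst gf_2413_4213_by_position_of_min[where p = z and q = "t * x"
          and g = "wt t x z False True"])
      (auto simp: wt_Cons_ascent below_def wt_min_last wt_inflated wt_singleton)
  then show "N = fps_const y * fps_X + Q y * N" unfolding N_def .
  let ?f = "\<lambda>xs. of_nat (Suc (card (cuts xs))) * wt t x 1 False True xs"
  have eq: "gf B (\<lambda>xs. of_nat (card (cuts xs)) * wt t x 1 False True xs)
    = fps_const (of_nat (card (cuts [1])) * wt t x 1 False True [1]) * fps_X
      + (fps_const 1 * fps_X + fps_const (t * x) * fps_X + fps_const t * fps_X * gf B ?f) * gf B ?f"
    unfolding B_def
  proof (rule gf_2413_4213_by_position_of_min)
    fix a v assume *: "below [a] v" "v \<noteq> []" "distinct (a # v)"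
    then have "card (cuts (a # v)) = Suc (card (cuts v))" "a < hd v"
      unfolding cuts_min_first[OF *(1)] by (auto simp: cuts_def below_def)
    then show "of_nat (card (cuts (a # v))) * wt t x 1 False True (a # v) = 1 * ?f v"
      using wt_Cons_ascent[of v a t x 1 True] * by simp
  next
    fix m u assume *: "below [m] u" "u \<noteq> []" "distinct (u @ [m])"
    then have "card (cuts (u @ [m])) = Suc (card (cuts u))"
      unfolding cuts_min_last[OF *(1)] by (auto simp: cuts_def)
    then show "of_nat (card (cuts (u @ [m]))) * wt t x 1 False True (u @ [m]) = t * x * ?f u"
      unfolding wt_min_last[OF *(1,2)] by (simp only: ac_simps)
  next
    fix u m v c assume *: "distinct (u @ m # v)" "inflated u m v c" "avoids_2413_4213 (u @ m # v)"
    then have "c \<notin> cuts u" by (auto simp: cuts_def inflated_def)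
    then have "card (cuts (u @ m # v)) = Suc (card (cuts u))"
      unfolding cuts_inflated[OF *(2,3)] by simp
    then show "of_nat (card (cuts (u @ m # v))) * wt t x 1 False True (u @ m # v)
      = t * ?f u * wt t x 1 False True v"
      unfolding wt_inflated[OF *(2)] by (simp only: ac_simps)
  qed simp
  have "cuts [1] = {1}" by (auto simp: cuts_def)
  then have "H = fps_X + Q 1 * (S + H)"
    by (intro trans[OF eq[unfolded C, folded H_def]]) (simp add: Q_def wt_singleton)
  also have "\<dots> = (fps_const 1 * fps_X + Q 1 * S) + Q 1 * H" by (simp add: algebra_simps)
  also have "fps_const 1 * fps_X + Q 1 * S = S" using N[of 1] unfolding S_def by simp
  finally show "H = S + Q 1 * H" .
qed

end

text \<open>
  Both \<open>z H\<close> and \<open>S\<^sup>2\<close> become \<open>z S\<close> after multiplication with \<open>1 - Q 1\<close>. This turns the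
  recursion through \<open>H\<close> into the equation that separable permutations satisfy.
\<close>

theorem gf_2413_4213_equation:
  fixes t x y :: "'a::idom"
  defines "B \<equiv> \<lambda>xs. avoids_2413_4213 xs \<and> xs \<noteq> []"
  defines "N \<equiv> gf B (wt t x y False True)" and "S \<equiv> gf B (wt t x 1 False True)"
  shows "N = fps_const y * fps_X * (1 + N)
    + fps_const t * N * (fps_const x * fps_X + fps_X * S + S * S)"
proof -
  define H where "H = gf B (\<lambda>xs. of_nat (card (cuts xs)) * wt t x 1 False True xs)"
  define Q where "Q = (\<lambda>y. fps_const y * fps_X + fps_const (t * x) * fps_X
    + fps_const t * fps_X * (S + H))"
  have N: "N = fps_const y * fps_X + Q y * N" and S: "S = fps_const 1 * fps_X + Q 1 * S"
    and H: "H = S + Q 1 * H"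
    using gf_2413_4213_equations(1)[where t = t and x = x and y = y]
      gf_2413_4213_equations(1)[where t = t and x = x and y = 1]
      gf_2413_4213_equations(2)[where t = t and x = x]
    unfolding N_def S_def H_def Q_def B_def by blast+
  have "fps_nth (1 - Q 1) 0 = 1" by (simp add: Q_def)
  then have "1 - Q 1 \<noteq> 0" by (metis fps_zero_nth zero_neq_one)
  moreover have "(1 - Q 1) * (fps_X * H) = (1 - Q 1) * (S * S)"
  proof -
    have HS: "H - Q 1 * H = S" using H by (metis add_diff_cancel_right')
    have SX: "S - Q 1 * S = fps_X" using S by (metis add_diff_cancel_right' fps_const_1_eq_1 mult_1)
    have "(1 - Q 1) * (fps_X * H) = fps_X * (H - Q 1 * H)" by (simp add: algebra_simps)
    also have "\<dots> = (S - Q 1 * S) * S" by (simp only: HS SX)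
    also have "\<dots> = (1 - Q 1) * (S * S)" by (simp add: algebra_simps)
    finally show ?thesis .
  qed
  ultimately have XH: "fps_X * H = S * S" by simp
  have "fps_const y * fps_X + Q y * N = fps_const y * fps_X * (1 + N)
    + fps_const t * N * (fps_const x * fps_X + fps_X * S + fps_X * H)"
    unfolding Q_def by (simp add: algebra_simps flip: fps_const_mult)
  then show ?thesis unfolding XH N[symmetric] .
qed

section \<open>Uniqueness of the solution of the functional equation\<close>

lemma fps_linear_equation_unique:
  fixes N N' S S' :: "'a::idom fps"
  assumes "N = fps_const y * fps_X * (1 + N) + fps_const t * N * (fps_const x * fps_X + fps_X * S + S * S)"
    and "N' = fps_const y * fps_X * (1 + N') + fps_const t * N' * (fps_const x * fps_X + fps_X * S + S * S)"
    and "fps_nth S 0 = 0"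
  shows "N = N'"
proof -
  define D where "D = 1 - fps_const y * fps_X - fps_const t * (fps_const x * fps_X + fps_X * S + S * S)"
  have "D * N = fps_const y * fps_X" "D * N' = fps_const y * fps_X"
    using assms(1,2) unfolding D_def by (simp_all add: algebra_simps) 
  moreover have "fps_nth D 0 = 1" using assms(3) by (simp add: D_def fps_mult_nth_0)
  then have "D \<noteq> 0" by (metis fps_zero_nth zero_neq_one)
  ultimately show ?thesis by (metis mult_cancel_left)
qed

text \<open>
  The difference of two solutions is annihilated by a power series with constant coefficient \<open>1\<close>.
\<close>

lemma fps_cubic_unique:
  fixes S S' :: "'a::idom fps"
  assumes S: "S = fps_X * (1 + S) + fps_const t * S * (fps_const x * fps_X + fps_X * S + S * S)"
    and S': "S' = fps_X * (1 + S') + fps_const t * S' * (fps_const x * fps_X + fps_X * S' + S' * S')"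
    and 0: "fps_nth S 0 = 0" "fps_nth S' 0 = 0"
  shows "S = S'"
proof -
  define D where "D = 1 - fps_X - fps_const t * (fps_const x * fps_X + fps_X * (S + S')
    + S * S + S * S' + S' * S')"
  define R where "R = (\<lambda>S. fps_X * (1 + S) + fps_const t * S * (fps_const x * fps_X + fps_X * S + S * S))"
  have "(S - S') * D = (S - R S) - (S' - R S')"
    unfolding D_def R_def by (simp add: algebra_simps)
  also have "\<dots> = 0" using S S' unfolding R_def by simp
  finally have "(S - S') * D = 0" .
  moreover have "fps_nth D 0 = 1" using 0 by (simp add: D_def fps_mult_nth_0)
  then have "D \<noteq> 0" by (metis fps_zero_nth zero_neq_one)
  ultimately show ?thesis by simp
qed

section \<open>One-line notation\<close>

lemma subseq_map_upt:
  fixes p :: "nat \<Rightarrow> nat"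
  shows "subseq (a # xs) (map p [m..<n]) \<longleftrightarrow>
    (\<exists>i. m \<le> i \<and> i < n \<and> p i = a \<and> subseq xs (map p [Suc i..<n]))"
proof (cases "m \<le> n")
  case True
  then show ?thesis
  proof (induction m rule: inc_induct)
    case (step m)
    have "subseq (a # xs) (map p [m..<n]) \<longleftrightarrow>
      a = p m \<and> subseq xs (map p [Suc m..<n]) \<or> subseq (a # xs) (map p [Suc m..<n])"
      using step(2) by (simp only: upt_conv_Cons list.map subseq_Cons_expand)
    also have "\<dots> \<longleftrightarrow> (\<exists>i. m \<le> i \<and> i < n \<and> p i = a \<and> subseq xs (map p [Suc i..<n]))"
      unfolding step(3) using step(2) by (metis Suc_leD Suc_le_eq le_eq_less_or_eq order_refl)
    finally show ?case .
  qed simp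
qed simp

lemma contains_pattern_4_iff:
  assumes "length \<sigma> = 4"
  shows "contains_pattern n \<pi> \<sigma> \<longleftrightarrow> (\<exists>i j k l. 1 \<le> i \<and> i < j \<and> j < k \<and> k < l \<and> l \<le> n \<and>
    (\<pi> i < \<pi> j \<longleftrightarrow> \<sigma> ! 0 < \<sigma> ! 1) \<and> (\<pi> i < \<pi> k \<longleftrightarrow> \<sigma> ! 0 < \<sigma> ! 2) \<and>
    (\<pi> i < \<pi> l \<longleftrightarrow> \<sigma> ! 0 < \<sigma> ! 3) \<and> (\<pi> j < \<pi> k \<longleftrightarrow> \<sigma> ! 1 < \<sigma> ! 2) \<and>
    (\<pi> j < \<pi> l \<longleftrightarrow> \<sigma> ! 1 < \<sigma> ! 3) \<and> (\<pi> k < \<pi> l \<longleftrightarrow> \<sigma> ! 2 < \<sigma> ! 3))"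
    (is "_ \<longleftrightarrow> (\<exists>i j k l. ?Q i j k l)")
proof
  assume "contains_pattern n \<pi> \<sigma>"
  then obtain j where j: "strict_mono_on {1..4} j" "j ` {1..4} \<subseteq> {1..n}"
    "\<And>a b. 1 \<le> a \<Longrightarrow> a < b \<Longrightarrow> b \<le> 4 \<Longrightarrow> \<pi> (j a) < \<pi> (j b) \<longleftrightarrow> \<sigma> ! (a - 1) < \<sigma> ! (b - 1)"
    unfolding contains_pattern_def assms by blast
  have "j 1 \<in> j ` {1..4}" "j 4 \<in> j ` {1..4}" by (rule imageI, simp)+
  then have "1 \<le> j 1" "j 4 \<le> n" using subsetD[OF j(2)] by auto
  moreover have "j 1 < j 2" "j 2 < j 3" "j 3 < j 4"
    using j(1) by (auto simp: strict_mono_on_def)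
  ultimately have "?Q (j 1) (j 2) (j 3) (j 4)"
    using j(3)[of 1 2] j(3)[of 1 3] j(3)[of 1 4] j(3)[of 2 3] j(3)[of 2 4] j(3)[of 3 4] by simp
  then show "\<exists>i j k l. ?Q i j k l" by blast
next
  assume "\<exists>i j k l. ?Q i j k l"
  then obtain i j k l where q: "?Q i j k l" by blast
  define f where "f = (\<lambda>a::nat. if a = 1 then i else if a = 2 then j else if a = 3 then k else l)"
  have four: "a = 1 \<or> a = 2 \<or> a = 3 \<or> a = 4" if "1 \<le> a" "a \<le> 4" for a :: nat
    using that by auto
  have "strict_mono_on {1..4} f"
  proof (rule strict_mono_onI)
    fix a b :: nat assume "a \<in> {1..4}" "b \<in> {1..4}" "a < b"
    then show "f a < f b" using four[of a] four[of b] q by (auto simp: f_def)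
  qed
  moreover have "f ` {1..4} \<subseteq> {1..n}" using q by (auto simp: f_def)
  moreover have "\<forall>a b. 1 \<le> a \<and> a < b \<and> b \<le> 4 \<longrightarrow>
      (\<pi> (f a) < \<pi> (f b) \<longleftrightarrow> \<sigma> ! (a - 1) < \<sigma> ! (b - 1))"
  proof (intro allI impI)
    fix a b :: nat assume ab: "1 \<le> a \<and> a < b \<and> b \<le> 4"
    then have "a = 1 \<and> b = 2 \<or> a = 1 \<and> b = 3 \<or> a = 1 \<and> b = 4 \<or> a = 2 \<and> b = 3 \<or> a = 2 \<and> b = 4
      \<or> a = 3 \<and> b = 4" by auto
    then show "\<pi> (f a) < \<pi> (f b) \<longleftrightarrow> \<sigma> ! (a - 1) < \<sigma> ! (b - 1)"
      using q by (elim disjE) (simp_all add: f_def)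
  qed
  ultimately show "contains_pattern n \<pi> \<sigma>" unfolding contains_pattern_def assms by blast
qed

definition one_line :: "nat \<Rightarrow> (nat \<Rightarrow> nat) \<Rightarrow> nat list" where
  "one_line n \<pi> = map \<pi> [1..<Suc n]"

lemma set_one_line: "set (one_line n \<pi>) = \<pi> ` {1..n}"
  unfolding one_line_def set_map set_upt atLeastLessThanSuc_atLeastAtMost ..

lemma distinct_one_line: "distinct (one_line n \<pi>) \<longleftrightarrow> inj_on \<pi> {1..n}"
  unfolding one_line_def distinct_map set_upt atLeastLessThanSuc_atLeastAtMost by simp

lemma not_contains_pattern_iff_avoids:
  assumes "length \<sigma> = 4" "inj_on \<pi> {1..n}"
    and "\<And>a b c d. distinct [a, b, c, d] \<Longrightarrow> R a b c d \<longleftrightarrow>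
      (a < b \<longleftrightarrow> \<sigma> ! 0 < \<sigma> ! 1) \<and> (a < c \<longleftrightarrow> \<sigma> ! 0 < \<sigma> ! 2) \<and> (a < d \<longleftrightarrow> \<sigma> ! 0 < \<sigma> ! 3) \<and>
      (b < c \<longleftrightarrow> \<sigma> ! 1 < \<sigma> ! 2) \<and> (b < d \<longleftrightarrow> \<sigma> ! 1 < \<sigma> ! 3) \<and> (c < d \<longleftrightarrow> \<sigma> ! 2 < \<sigma> ! 3)"
  shows "\<not> contains_pattern n \<pi> \<sigma> \<longleftrightarrow> avoids R (one_line n \<pi>)"
proof -
  have dist: "distinct [\<pi> i, \<pi> j, \<pi> k, \<pi> l]" if "1 \<le> i" "i < j" "j < k" "k < l" "l \<le> n" for i j k l
    using that assms(2) by (auto dest: inj_onD)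
  have occurs: "subseq [a, b, c, d] (one_line n \<pi>) \<longleftrightarrow> (\<exists>i j k l. 1 \<le> i \<and> i < j \<and> j < k \<and>
      k < l \<and> l \<le> n \<and> a = \<pi> i \<and> b = \<pi> j \<and> c = \<pi> k \<and> d = \<pi> l)" (is "?L \<longleftrightarrow> ?R") for a b c d
  proof
    assume ?L
    then show ?R unfolding one_line_def subseq_map_upt Suc_le_eq less_Suc_eq_le by blast
  next
    assume ?R
    then obtain i j k l where "1 \<le> i" "i < j" "j < k" "k < l" "l \<le> n"
      "a = \<pi> i" "b = \<pi> j" "c = \<pi> k" "d = \<pi> l" by blast
    then show ?L unfolding one_line_def subseq_map_upt
      by (intro exI[of _ i] conjI exI[of _ j] exI[of _ k] exI[of _ l]) auto
  qed
  have "avoids R (one_line n \<pi>) \<longleftrightarrow> (\<forall>i j k l. 1 \<le> i \<and> i < j \<and> j < k \<and> k < l \<and> l \<le> n \<longrightarrow>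
      \<not> R (\<pi> i) (\<pi> j) (\<pi> k) (\<pi> l))"
    unfolding avoids_def occurs by blast
  also have "\<dots> \<longleftrightarrow> \<not> contains_pattern n \<pi> \<sigma>"
    unfolding contains_pattern_4_iff[OF assms(1)] using assms(3)[OF dist] by blast
  finally show ?thesis ..
qed

lemma descents_map_upt:
  fixes p :: "nat \<Rightarrow> nat"
  assumes "m < n"
  shows "descents (map p [m..<n]) = card {i \<in> {m..<n - 1}. p (i + 1) < p i}"
  using assms
proof (induction "n - m" arbitrary: m)
  case (Suc d)
  show ?case
  proof (cases "Suc m = n")
    case True
    then show ?thesis by (simp add: upt_conv_Cons)
  next
    case False
    then have m: "Suc m < n" using Suc.prems by simp
    have "{i \<in> {m..<n - 1}. p (i + 1) < p i}
      = (if p (Suc m) < p m then {m} else {}) \<union> {i \<in> {Suc m..<n - 1}. p (i + 1) < p i}"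
      using m by (auto simp: le_less_Suc_eq Suc_le_eq le_less)
    then have "card {i \<in> {m..<n - 1}. p (i + 1) < p i}
      = (if p (Suc m) < p m then 1 else 0) + card {i \<in> {Suc m..<n - 1}. p (i + 1) < p i}"
      by (simp add: card_insert_if)
    moreover have "descents (map p [m..<n])
      = (if p (Suc m) < p m then 1 else 0) + descents (map p [Suc m..<n])"
      using m Suc.prems by (simp add: upt_conv_Cons)
    ultimately show ?thesis using Suc.hyps(1)[of "Suc m"] Suc.hyps(2) m by simp
  qed
qed simp

lemma double_descents_map_upt:
  fixes p :: "nat \<Rightarrow> nat"
  assumes "m < n" "1 \<le> m"
  shows "double_descents (p m < p (m - 1)) (map p [m..<n]) (p n < p (n - 1))
    = card {i \<in> {m..<n}. p i < p (i - 1) \<and> p (i + 1) < p i}"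
  using assms
proof (induction "n - m" arbitrary: m)
  case (Suc d)
  let ?D = "\<lambda>i. p i < p (i - 1) \<and> p (i + 1) < p i"
  have split: "card {i \<in> {m..<n}. ?D i} = (if ?D m then 1 else 0) + card {i \<in> {Suc m..<n}. ?D i}"
  proof -
    have "{i \<in> {m..<n}. ?D i} = (if ?D m then {m} else {}) \<union> {i \<in> {Suc m..<n}. ?D i}"
      using Suc.prems(1) by (auto simp: Suc_le_eq le_less)
    then show ?thesis by (simp add: card_insert_if)
  qed
  show ?case
  proof (cases "Suc m = n")
    case True
    then show ?thesis using split by (auto simp: upt_conv_Cons)
  next
    case False
    then have m: "Suc m < n" using Suc.prems by simp
    have "double_descents (p m < p (m - 1)) (map p [m..<n]) (p n < p (n - 1))
      = (if ?D m then 1 else 0) + double_descents (p (Suc m) < p m) (map p [Suc m..<n]) (p n < p (n - 1))"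
      using m Suc.prems by (simp add: upt_conv_Cons)
    then show ?thesis using Suc.hyps(1)[of "Suc m"] Suc.hyps(2) m split by simp
  qed
qed simp

text \<open>
  Adding \<open>m\<close> and the successor account for the positions starting at \<open>m\<close>: the initial run ends at the
  first descent position, or at \<open>n\<close> if there is none.
\<close>

lemma initial_run_map_upt:
  fixes p :: "nat \<Rightarrow> nat"
  assumes "m \<le> n" "inj_on p {m..n}"
  shows "initial_run (map p [m..<Suc n]) + m = Suc (Min ({i \<in> {m..<n}. p (i + 1) < p i} \<union> {n}))"
  using assms
proof (induction "n - m" arbitrary: m)
  case 0
  then show ?case by simp
next
  case (Suc d)
  then have m: "m < n" by simp
  have "[m..<Suc n] = m # Suc m # [Suc (Suc m)..<Suc n]" "[Suc m..<Suc n] = Suc m # [Suc (Suc m)..<Suc n]"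
    using m by (simp_all add: upt_conv_Cons del: upt_Suc)
  then have run: "initial_run (map p [m..<Suc n])
    = (if p m < p (Suc m) then Suc (initial_run (map p [Suc m..<Suc n])) else 1)"
    by (simp del: upt_Suc)
  show ?case
  proof (cases "p (Suc m) < p m")
    case True
    then have "Min ({i \<in> {m..<n}. p (i + 1) < p i} \<union> {n}) = m"
      using m by (intro Min_eqI) auto
    then show ?thesis using run True by simp
  next
    case False
    have "p m \<noteq> p (Suc m)" using Suc.prems(2) m by (auto dest: inj_onD)
    then have "p m < p (Suc m)" using False by simp
    moreover have "{i \<in> {m..<n}. p (i + 1) < p i} = {i \<in> {Suc m..<n}. p (i + 1) < p i}"
      using False by (auto simp: Suc_le_eq le_less)
    moreover have "inj_on p {Suc m..n}" using Suc.prems(2) by (rule inj_on_subset) auto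
    ultimately show ?thesis using run Suc.hyps(1)[of "Suc m"] Suc.hyps(2) m by simp
  qed
qed

lemma wt_one_line:
  fixes t x y :: "'a::comm_ring_1"
  assumes \<pi>: "\<pi> permutes {1..n}" and n: "n \<ge> 1"
  shows "wt t x y False True (one_line n \<pi>) = t ^ des n \<pi> * x ^ dd n \<pi> * y ^ iar n \<pi>"
proof -
  have inj: "inj_on \<pi> {1..n}" using permutes_inj[OF \<pi>] by (rule inj_on_subset) auto
  have lt: "1 < Suc n" using n by simp
  have "descents (one_line n \<pi>) = des n \<pi>"
    using descents_map_upt[OF lt, of \<pi>] n unfolding des_def DES_def one_line_def
    by (simp add: atLeastLessThanSuc_atLeastAtMost[symmetric] del: upt_Suc)
  moreover have "double_descents False (one_line n \<pi>) True = dd n \<pi>"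
  proof -
    have pos: "\<pi> i \<ge> 1" if "i \<in> {1..n}" for i using permutes_in_image[OF \<pi>, of i] that by simp
    have line: "one_line n \<pi> = map (pad n \<pi>) [1..<Suc n]" by (auto simp: one_line_def pad_def)
    have ends: "(pad n \<pi> 1 < pad n \<pi> (1 - 1)) = False"
      "(pad n \<pi> (Suc n) < pad n \<pi> (Suc n - 1)) = True"
      using n pos[of n] by (auto simp: pad_def)
    show ?thesis
      using double_descents_map_upt[OF lt order_refl, of "pad n \<pi>"]
      unfolding ends atLeastLessThanSuc_atLeastAtMost line[symmetric] dd_def .
  qed
  moreover have "initial_run (one_line n \<pi>) = iar n \<pi>"
  proof -
    have "{1..<n} = {1..n - 1}" using n by auto
    then show ?thesis
      using initial_run_map_upt[OF n inj] unfolding iar_def DES_def one_line_def by (simp del: upt_Suc)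
  qed
  ultimately show ?thesis by (simp add: wt_def)
qed

text \<open>
  Injectivity suffices, as both sets have \<open>n!\<close> elements.
\<close>

lemma bij_betw_one_line:
  "bij_betw (one_line n) {\<pi>. \<pi> permutes {1..n}} (permutations_of_set {1..n})"
proof -
  have inj: "inj_on (one_line n) {\<pi>. \<pi> permutes {1..n}}"
  proof (rule inj_onI)
    fix \<pi> \<rho> assume *: "\<pi> \<in> {\<pi>. \<pi> permutes {1..n}}" "\<rho> \<in> {\<pi>. \<pi> permutes {1..n}}"
      and eq: "one_line n \<pi> = one_line n \<rho>"
    show "\<pi> = \<rho>"
    proof
      fix i
      show "\<pi> i = \<rho> i"
      proof (cases "i \<in> {1..n}")
        case True
        then show ?thesis using eq by (auto simp: one_line_def)
      next
        case False
        then show ?thesis using * by (auto simp: permutes_def)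
      qed
    qed
  qed
  have "one_line n ` {\<pi>. \<pi> permutes {1..n}} \<subseteq> permutations_of_set {1..n}"
  proof (rule image_subsetI)
    fix \<pi> assume "\<pi> \<in> {\<pi>. \<pi> permutes {1..n}}"
    then have \<pi>: "\<pi> permutes {1..n}" by simp
    have "set (one_line n \<pi>) = {1..n}" using permutes_image[OF \<pi>] by (simp add: set_one_line)
    moreover have "distinct (one_line n \<pi>)"
      using permutes_inj[OF \<pi>] by (auto simp: distinct_one_line intro: inj_on_subset)
    ultimately show "one_line n \<pi> \<in> permutations_of_set {1..n}" by (auto simp: permutations_of_set_def)
  qed
  moreover have "card (one_line n ` {\<pi>. \<pi> permutes {1..n}}) = card (permutations_of_set {1..n})"
    unfolding card_image[OF inj] by (simp add: card_permutations)
  ultimately have "one_line n ` {\<pi>. \<pi> permutes {1..n}} = permutations_of_set {1..n}"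
    by (intro card_subset_eq) auto
  then show ?thesis using inj by (simp add: bij_betw_def)
qed

lemma sum_avoiders_eq_gf_nth:
  assumes n: "n \<ge> 1"
    and P: "\<And>\<pi>. \<pi> permutes {1..n} \<Longrightarrow>
      \<not> contains_pattern n \<pi> \<sigma> \<and> \<not> contains_pattern n \<pi> \<tau> \<longleftrightarrow> P (one_line n \<pi>)"
  shows "(\<Sum>\<pi>\<in>avoiders n \<sigma> \<tau>. t ^ des n \<pi> * x ^ dd n \<pi> * y ^ iar n \<pi>)
    = fps_nth (gf P (wt t x y False True)) n"
proof -
  have "bij_betw (one_line n) (avoiders n \<sigma> \<tau>) {xs. xs \<in> permutations_of_set {1..n} \<and> P xs}"
  proof -
    have "avoiders n \<sigma> \<tau> \<subseteq> {\<pi>. \<pi> permutes {1..n}}" by (auto simp: avoiders_def)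
    moreover have "one_line n ` avoiders n \<sigma> \<tau> = {xs. xs \<in> permutations_of_set {1..n} \<and> P xs}"
    proof -
      have perms: "permutations_of_set {1..n} = one_line n ` {\<pi>. \<pi> permutes {1..n}}"
        using bij_betw_one_line by (simp only: bij_betw_def)
      have "avoiders n \<sigma> \<tau> = {\<pi> \<in> {\<pi>. \<pi> permutes {1..n}}. P (one_line n \<pi>)}"
        using P unfolding avoiders_def by blast
      then show ?thesis unfolding perms by auto
    qed
    ultimately show ?thesis using bij_betw_subset[OF bij_betw_one_line] by metis
  qed
  then have "fps_nth (gf P (wt t x y False True)) n
    = (\<Sum>\<pi>\<in>avoiders n \<sigma> \<tau>. wt t x y False True (one_line n \<pi>))"
    unfolding gf_nth by (rule sum.reindex_bij_betw[symmetric])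
  also have "\<dots> = (\<Sum>\<pi>\<in>avoiders n \<sigma> \<tau>. t ^ des n \<pi> * x ^ dd n \<pi> * y ^ iar n \<pi>)"
    by (intro sum.cong refl wt_one_line n) (auto simp: avoiders_def)
  finally show ?thesis ..
qed

lemma not_contains_pattern_iff:
  assumes "\<pi> permutes {1..n}"
  shows "\<not> contains_pattern n \<pi> [2, 4, 1, 3] \<longleftrightarrow> avoids p2413 (one_line n \<pi>)"
    and "\<not> contains_pattern n \<pi> [3, 1, 4, 2] \<longleftrightarrow> avoids p3142 (one_line n \<pi>)"
    and "\<not> contains_pattern n \<pi> [4, 2, 1, 3] \<longleftrightarrow> avoids p4213 (one_line n \<pi>)"
proof -
  have inj: "inj_on \<pi> {1..n}" using permutes_inj[OF assms] by (rule inj_on_subset) auto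
  show "\<not> contains_pattern n \<pi> [2, 4, 1, 3] \<longleftrightarrow> avoids p2413 (one_line n \<pi>)"
    by (rule not_contains_pattern_iff_avoids[OF _ inj]) (auto simp: p2413_def eval_nat_numeral)
  show "\<not> contains_pattern n \<pi> [3, 1, 4, 2] \<longleftrightarrow> avoids p3142 (one_line n \<pi>)"
    by (rule not_contains_pattern_iff_avoids[OF _ inj]) (auto simp: p3142_def eval_nat_numeral)
  show "\<not> contains_pattern n \<pi> [4, 2, 1, 3] \<longleftrightarrow> avoids p4213 (one_line n \<pi>)"
    by (rule not_contains_pattern_iff_avoids[OF _ inj]) (auto simp: p4213_def eval_nat_numeral)
qed

section \<open>Equidistribution\<close>

theorem gf_separable_eq_gf_2413_4213:
  fixes t x y :: "'a::idom"
  shows "gf (separable_ends (\<lambda>_ _. True)) (wt t x y False True)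
    = gf (\<lambda>xs. avoids_2413_4213 xs \<and> xs \<noteq> []) (wt t x y False True)"
proof -
  let ?A = "separable_ends (\<lambda>_ _. True)" and ?B = "\<lambda>xs. avoids_2413_4213 xs \<and> xs \<noteq> []"
  have zero: "fps_nth (gf ?A (wt t x 1 False True)) 0 = 0" "fps_nth (gf ?B (wt t x 1 False True)) 0 = 0"
    by (auto simp: gf_nth separable_ends_def intro!: sum.neutral)
  have S: "gf ?A (wt t x 1 False True) = gf ?B (wt t x 1 False True)"
    by (rule fps_cubic_unique[OF
          separable_gf_equation[where t = t and x = x and y = 1, unfolded fps_const_1_eq_1 mult_1_left]
          gf_2413_4213_equation[where t = t and x = x and y = 1, unfolded fps_const_1_eq_1 mult_1_left]
          zero])
  show ?thesis
    by (rule fps_linear_equation_unique[OF separable_gf_equation[where t = t and x = x and y = y]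
          gf_2413_4213_equation[where t = t and x = x and y = y, folded S] zero(1)])
qed

theorem theorem1p5:
  fixes n :: nat
  assumes "n \<ge> 1"
  shows "(\<Sum>\<pi>\<in>avoiders n [2, 4, 1, 3] [3, 1, 4, 2].
            var_t ^ des n \<pi> * var_x ^ dd n \<pi> * var_y ^ iar n \<pi>)
       = (\<Sum>\<pi>\<in>avoiders n [2, 4, 1, 3] [4, 2, 1, 3].
            var_t ^ des n \<pi> * var_x ^ dd n \<pi> * var_y ^ iar n \<pi>)"
proof -
  have ne: "one_line n \<pi> \<noteq> []" for \<pi> using assms by (simp add: one_line_def)
  have "(\<Sum>\<pi>\<in>avoiders n [2, 4, 1, 3] [3, 1, 4, 2].
          var_t ^ des n \<pi> * var_x ^ dd n \<pi> * var_y ^ iar n \<pi>)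
      = fps_nth (gf (separable_ends (\<lambda>_ _. True)) (wt var_t var_x var_y False True)) n"
    using ne by (intro sum_avoiders_eq_gf_nth[OF assms])
      (simp del: One_nat_def add: not_contains_pattern_iff separable_ends_def separable_def)
  also have "\<dots> = fps_nth (gf (\<lambda>xs. avoids_2413_4213 xs \<and> xs \<noteq> []) (wt var_t var_x var_y False True)) n"
    by (simp only: gf_separable_eq_gf_2413_4213)
  also have "\<dots> = (\<Sum>\<pi>\<in>avoiders n [2, 4, 1, 3] [4, 2, 1, 3].
          var_t ^ des n \<pi> * var_x ^ dd n \<pi> * var_y ^ iar n \<pi>)"
    using ne by (intro sum_avoiders_eq_gf_nth[OF assms, symmetric])
      (simp del: One_nat_def add: not_contains_pattern_iff avoids_2413_4213_def)
  finally show ?thesis .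
qed

end
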